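(* Let $(E,d)$ be a locally compact separable metric space, let $X=(X_t,\,t\ge 0)$ be a Markov process with state space $E$ and associated family of probability measures $(P_x,\,x\in E)$, such that for every $f\in B(E)$ the map $(t,x)\mapsto E_x(f(X_t))$ is measurable from $\mathbb{R}_+\times E$ into $\mathbb{R}$. Let $U=(U_t,\,t\ge 0)$ and $R=(R_\lambda,\,\lambda>0)$ be the semigroup and the resolvent on $B(E)$ associated with $X$, i.e. $U_t f(x)=E_x(f(X_t))$ and $R_\lambda f(x)=\int_0^\infty e^{-\lambda t}U_t f(x)\,dt$. Then the following statements are equivalent: \begin{enumerate} \item[(a)] $U$ is Feller. \item[(b)] $R$ is Feller. \item[(c)] $U_t C_0(E)\subset C_0(E)$ for all $t\ge 0$, and for all $f\in C_0(E)$, $x\in E$, $\lim_{t\downarrow 0}U_t f(x)=f(x)$. \item[(d)] $U_t C_0(E)\subset C_0(E)$ for all $t\ge 0$, and for all $f\in C_0(E)$, $x\in E$, $\lim_{\lambda\to\infty}\lambda R_\lambda f(x)=f(x)$. \item[(e)] $R_\lambda C_0(E)\subset C_0(E)$ for all $\lambda>0$, and for all $f\in C_0(E)$, $x\in E$, $\lim_{t\downarrow 0}U_t f(x)=f(x)$. \item[(f)] $R_\lambda C_0(E)\subset C_0(E)$ for all $\lambda>0$, and for all $f\in C_0(E)$, $x\in E$, $\lim_{\lambda\to\infty}\lambda R_\lambda f(x)=f(x)$. \end{enumerate}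
   Context: $\mathcal{B}(E)$ is the Borel $\sigma$-algebra of $E$; $B(E)$ is the space of bounded measurable real-valued functions on $E$, and $C_0(E)\subset B(E)$ is the subspace of continuous functions vanishing at infinity; both carry the sup-norm $\|\cdot\|$. The Markov process $X$ is (time-homogeneous and) defined on a measurable space $(\Omega,\mathcal{A})$ carrying the probability measures $P_x$, $x\in E$, with $P_x(X_0=x)=1$; $E_x(\cdot)$ denotes expectation with respect to $P_x$. $X$ satisfies the simple Markov property, $E_x(f(X_{t+s})\mid \mathcal{F}_s)=E_{X_s}(f(X_t))$ $P_x$-a.s. for all $f\in B(E)$, $s,t\ge 0$, $x\in E$, where $\mathcal{F}_s=\sigma(X_r,\,r\le s)$. In particular $U_{t+s}=U_t\circ U_s$ on $B(E)$. No path regularity is assumed. A Feller semigroup is a family $(U_t,\,t\ge 0)$ of positive linear operators on $C_0(E)$ such that (i) $U_0=\mathrm{id}$ and $\|U_t\|\le 1$ for every $t\ge 0$; (ii) $U_{t+s}=U_t\circ U_s$ for all $s,t\ge 0$; (iii) $\lim_{t\downarrow 0}\|U_t f-f\|=0$ for every $f\in C_0(E)$. A Feller resolvent is a family $(R_\lambda,\,\lambda>0)$ of positive linear operators on $C_0(E)$ such that (i) $\|R_\lambda\|\le\lambda^{-1}$ for every $\lambda>0$; (ii) $R_\lambda-R_\mu=(\mu-\lambda)R_\lambda\circ R_\mu$ for all $\lambda,\mu>0$; (iii) $\lim_{\lambda\to\infty}\|\lambda R_\lambda f-f\|=0$ for every $f\in C_0(E)$. "$U$ is Feller" means that the operators $U_t$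 on $B(E)$ map $C_0(E)$ into itself and their restrictions to $C_0(E)$ form a Feller semigroup; "$R$ is Feller" means that the operators $R_\lambda$ map $C_0(E)$ into itself and their restrictions to $C_0(E)$ form a Feller resolvent. *)

theory Defs
  imports "HOL-Probability.Probability"
begin

section \<open>Function spaces\<close>

definition bounded_borel :: "('e::topological_space \<Rightarrow> real) set" where
  "bounded_borel = {f. f \<in> borel_measurable borel \<and> bounded (range f)}"

definition C0 :: "('e::topological_space \<Rightarrow> real) set" where
  "C0 = {f. continuous_on UNIV f \<and> (\<forall>\<epsilon>>0. \<exists>K. compact K \<and> (\<forall>x. x \<notin> K \<longrightarrow> \<bar>f x\<bar> < \<epsilon>))}"

lemma C0_subset_bounded_borel: "C0 \<subseteq> bounded_borel"
proof
  fix f :: "'a \<Rightarrow> real" assume f: "f \<in> C0"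
  then have cont: "continuous_on UNIV f" by (simp add: C0_def)
  have "\<exists>K. compact K \<and> (\<forall>x. x \<notin> K \<longrightarrow> \<bar>f x\<bar> < 1)"
    using f by (simp add: C0_def)
  then obtain K where K: "compact K" "\<And>x. x \<notin> K \<Longrightarrow> \<bar>f x\<bar> < 1" by blast
  have "bounded (f ` K)"
    using K(1) cont by (meson compact_continuous_image compact_imp_bounded continuous_on_subset subset_UNIV)
  then have "bounded (f ` K \<union> cball 0 1)" by simp
  moreover have "range f \<subseteq> f ` K \<union> cball 0 1"
    using K(2) by (force simp: less_imp_le)
  ultimately have "bounded (range f)" by (rule bounded_subset)
  with cont show "f \<in> bounded_borel"
    by (simp add: bounded_borel_def borel_measurable_continuous_onI)
qed

text \<open>The supremum is a real one, hence meaningful only for bounded \<open>f\<close>.\<close>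

definition sup_norm :: "('e \<Rightarrow> real) \<Rightarrow> real" where
  "sup_norm f = (SUP x. \<bar>f x\<bar>)"


section \<open>Feller semigroups and resolvents\<close>

text \<open>An operator on \<open>C0\<close> is represented by a total map on functions, of which only the
  values on \<open>C0\<close> matter. The predicates below therefore apply directly to
  operators given on \<open>bounded_borel\<close> and speak about their restrictions to \<open>C0\<close>.\<close>

definition positive_linear_operator_C0 ::
    "(('e::topological_space \<Rightarrow> real) \<Rightarrow> ('e \<Rightarrow> real)) \<Rightarrow> bool" where
  "positive_linear_operator_C0 T \<longleftrightarrow>
     T ` C0 \<subseteq> C0 \<and>
     (\<forall>f\<in>C0. \<forall>g\<in>C0. T (\<lambda>x. f x + g x) = (\<lambda>x. T f x + T g x)) \<and>
     (\<forall>f\<in>C0. \<forall>c. T (\<lambda>x. c * f x) = (\<lambda>x. c * T f x)) \<and>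
     (\<forall>f\<in>C0. (\<forall>x. 0 \<le> f x) \<longrightarrow> (\<forall>x. 0 \<le> T f x))"

text \<open>The operator norm takes extended real values, so that unbounded operators have norm \<open>\<infinity>\<close>.\<close>

definition op_norm_C0 :: "(('e::topological_space \<Rightarrow> real) \<Rightarrow> ('e \<Rightarrow> real)) \<Rightarrow> ereal" where
  "op_norm_C0 T = (SUP f\<in>{f \<in> C0. sup_norm f \<le> 1}. ereal (sup_norm (T f)))"

definition feller_semigroup ::
    "(real \<Rightarrow> ('e::topological_space \<Rightarrow> real) \<Rightarrow> ('e \<Rightarrow> real)) \<Rightarrow> bool" where
  "feller_semigroup U \<longleftrightarrow>
     (\<forall>t\<ge>0. positive_linear_operator_C0 (U t)) \<and>
     (\<forall>f\<in>C0. U 0 f = f) \<and>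
     (\<forall>t\<ge>0. op_norm_C0 (U t) \<le> 1) \<and>
     (\<forall>s\<ge>0. \<forall>t\<ge>0. \<forall>f\<in>C0. U (t + s) f = U t (U s f)) \<and>
     (\<forall>f\<in>C0. ((\<lambda>t. sup_norm (\<lambda>x. U t f x - f x)) \<longlongrightarrow> 0) (at_right 0))"

definition feller_resolvent ::
    "(real \<Rightarrow> ('e::topological_space \<Rightarrow> real) \<Rightarrow> ('e \<Rightarrow> real)) \<Rightarrow> bool" where
  "feller_resolvent R \<longleftrightarrow>
     (\<forall>l>0. positive_linear_operator_C0 (R l)) \<and>
     (\<forall>l>0. op_norm_C0 (R l) \<le> ereal (1 / l)) \<and>
     (\<forall>l>0. \<forall>m>0. \<forall>f\<in>C0. \<forall>x. R l f x - R m f x = (m - l) * R l (R m f) x) \<and>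
     (\<forall>f\<in>C0. ((\<lambda>l. sup_norm (\<lambda>x. l * R l f x - f x)) \<longlongrightarrow> 0) at_top)"


section \<open>Markov processes\<close>

definition past_algebra :: "'w measure \<Rightarrow> (real \<Rightarrow> 'w \<Rightarrow> 'e::topological_space) \<Rightarrow> real \<Rightarrow> 'w measure" where
  "past_algebra A X s =
     sigma (space A) {X r -` B \<inter> space A | r B. 0 \<le> r \<and> r \<le> s \<and> B \<in> sets borel}"

definition semigroup_of ::
    "('e \<Rightarrow> 'w measure) \<Rightarrow> (real \<Rightarrow> 'w \<Rightarrow> 'e) \<Rightarrow> real \<Rightarrow> ('e \<Rightarrow> real) \<Rightarrow> ('e \<Rightarrow> real)" where
  "semigroup_of P X t f x = (\<integral>\<omega>. f (X t \<omega>) \<partial>P x)"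

definition resolvent_of ::
    "('e \<Rightarrow> 'w measure) \<Rightarrow> (real \<Rightarrow> 'w \<Rightarrow> 'e) \<Rightarrow> real \<Rightarrow> ('e \<Rightarrow> real) \<Rightarrow> ('e \<Rightarrow> real)" where
  "resolvent_of P X l f x = (LINT t:{0..}|lborel. exp (- l * t) * semigroup_of P X t f x)"

text \<open>Of \<open>A\<close> only the underlying measurable space is used. The index \<open>t\<close> of \<open>X t\<close> is relevant
  only for \<open>t \<ge> 0\<close>.\<close>

locale markov_process =
  fixes A :: "'w measure"
    and X :: "real \<Rightarrow> 'w \<Rightarrow> 'e::topological_space"
    and P :: "'e \<Rightarrow> 'w measure"
  assumes random_variables: "0 \<le> t \<Longrightarrow> X t \<in> measurable A borel"
    and sets_P: "sets (P x) = sets A"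
    and prob_P: "prob_space (P x)"
    and start: "AE \<omega> in P x. X 0 \<omega> = x"
    and markov_property:
      "\<lbrakk>f \<in> bounded_borel; 0 \<le> s; 0 \<le> t\<rbrakk> \<Longrightarrow>
        AE \<omega> in P x. real_cond_exp (P x) (past_algebra A X s) (\<lambda>\<omega>'. f (X (t + s) \<omega>')) \<omega>
          = (\<integral>\<omega>'. f (X t \<omega>') \<partial>P (X s \<omega>))"

end

theory Submission
  imports Defs
begin

text \<open>The only step that is not routine is that pointwise convergence \<open>l * R l f \<longrightarrow> f\<close> on \<open>C0\<close>
  is automatically uniform. The usual proof uses the Riesz and Hahn-Banach theorems; here it is
  replaced by a lattice argument. The set of \<open>f \<in> C0\<close> for which the convergence is uniform is a closed
  subspace containing the range of the resolvent, and by a Dini argument it is closed under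
  \<open>f \<mapsto> max f 0\<close>, so an approximation argument of Stone-Weierstrass type shows that it is all of \<open>C0\<close>.
  To pass from the resolvent to the semigroup, \<open>U t f\<close> is the uniform limit of the \<open>n\<close>-th powers of
  \<open>l * R l\<close> with \<open>l = n / t\<close>: for \<open>f\<close> in the range of \<open>R 1\<close> the operators \<open>l * R l\<close> and \<open>U (1 / l)\<close>
  differ by \<open>o(1 / l)\<close>, and telescoping adds up \<open>n\<close> such errors. Conversely, \<open>R l f\<close> inherits
  vanishing at infinity from the functions \<open>U t f\<close> by dominated convergence along sequences without
  convergent subsequence.\<close>

subsection \<open>Continuous functions vanishing at infinity\<close>

text \<open>Each of the other five statements weakens to (f), so the work is to recover everything
  from (f). Probabilistically, \<open>l * R l f x\<close> is the mean of \<open>U t f x\<close> over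
  an exponential time of rate \<open>l\<close>; bounds, limits and Fubini's theorem thereby become
  statements about probability measures. Two obstacles shape the proof. Constants do not in general
  belong to \<open>C0\<close>, so they can neither be fed into \<open>R l\<close> nor serve in a
  lattice approximation; positive parts and compact superlevel sets take their place. And (f) says
  nothing directly about continuity of \<open>U t f\<close>, which must therefore be reached through
  operators already known to preserve \<open>C0\<close>, such as powers of \<open>l * R l\<close>.
  The first-order agreement needed for the telescoping has a simple source: with
  \<open>h = R 1 g\<close>, both \<open>l * R l h\<close> and \<open>U (1 / l) h\<close> equal
  \<open>h + (h - g) / l\<close> up to a uniform \<open>o(1 / l)\<close>. The range of
  \<open>R 1\<close> is dense in the sup norm once the convergence of the resolvents is
  uniform.\<close>

lemma C0_continuous: "f \<in> C0 \<Longrightarrow> continuous_on UNIV f"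
  by (simp add: C0_def)

lemma C0_small_outside:
  "f \<in> C0 \<Longrightarrow> 0 < e \<Longrightarrow> \<exists>K. compact K \<and> (\<forall>x. x \<notin> K \<longrightarrow> \<bar>f x\<bar> < e)"
  by (simp add: C0_def)

lemma C0_compact_superlevel:
  assumes "f \<in> C0" "0 < e"
  shows "compact {x. e \<le> \<bar>f x\<bar>}"
proof -
  obtain K where K: "compact K" "\<And>x. x \<notin> K \<Longrightarrow> \<bar>f x\<bar> < e"
    using assms by (auto simp: C0_def)
  have "closed {x. e \<le> \<bar>f x\<bar>}"
    using C0_continuous[OF assms(1)] by (intro closed_Collect_le continuous_intros)
  moreover have "{x. e \<le> \<bar>f x\<bar>} = K \<inter> {x. e \<le> \<bar>f x\<bar>}"
    using K(2) by (force simp: not_less)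
  ultimately show ?thesis
    using K(1) by (metis compact_Int_closed)
qed

lemma C0I:
  assumes "continuous_on UNIV f" "\<And>e. 0 < e \<Longrightarrow> compact {x. e \<le> \<bar>f x\<bar>}"
  shows "f \<in> C0"
  unfolding C0_def using assms by (auto simp: not_le[symmetric])

lemma C0_boundedE:
  assumes "f \<in> C0"
  obtains c where "0 < c" "\<And>x. \<bar>f x\<bar> \<le> c"
proof -
  have "bounded (range f)"
    using assms C0_subset_bounded_borel by (auto simp: bounded_borel_def)
  then show ?thesis
    using that by (auto simp: bounded_pos)
qed

lemma C0_dominated:
  assumes "continuous_on UNIV f" "g \<in> C0" "h \<in> C0" "\<And>x. \<bar>f x\<bar> \<le> \<bar>g x\<bar> + \<bar>h x\<bar>"
  shows "f \<in> C0"
  unfolding C0_def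
proof (safe intro!: assms(1))
  fix e :: real assume "0 < e"
  then obtain K L where KL: "compact K" "compact L"
    "\<And>x. x \<notin> K \<Longrightarrow> \<bar>g x\<bar> < e/2" "\<And>x. x \<notin> L \<Longrightarrow> \<bar>h x\<bar> < e/2"
    using C0_small_outside[OF assms(2), of "e/2"] C0_small_outside[OF assms(3), of "e/2"] by auto
  have "\<bar>f x\<bar> < e" if "x \<notin> K \<union> L" for x
    using assms(4)[of x] KL(3,4)[of x] that by simp
  with KL(1,2) show "\<exists>K. compact K \<and> (\<forall>x. x \<notin> K \<longrightarrow> \<bar>f x\<bar> < e)"
    by (intro exI[of _ "K \<union> L"]) (auto simp: compact_Un)
qed

lemma C0_add: "f \<in> C0 \<Longrightarrow> g \<in> C0 \<Longrightarrow> (\<lambda>x. f x + g x) \<in> C0"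
  by (rule C0_dominated[of _ f g]) (auto intro!: continuous_intros dest: C0_continuous)

lemma C0_max: "f \<in> C0 \<Longrightarrow> g \<in> C0 \<Longrightarrow> (\<lambda>x. max (f x) (g x)) \<in> C0"
  by (rule C0_dominated[of _ f g]) (auto intro!: continuous_intros dest: C0_continuous)

lemma C0_zero: "(\<lambda>x. 0) \<in> C0"
  by (rule C0I) auto

lemma C0_scale:
  assumes "f \<in> C0"
  shows "(\<lambda>x. c * f x) \<in> C0"
proof (cases "c = 0")
  case False
  show ?thesis
  proof (rule C0I)
    fix e :: real assume "0 < e"
    then have "compact {x. e / \<bar>c\<bar> \<le> \<bar>f x\<bar>}"
      using False assms by (intro C0_compact_superlevel) auto
    also have "{x. e / \<bar>c\<bar> \<le> \<bar>f x\<bar>} = {x. e \<le> \<bar>c * f x\<bar>}"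
      using False by (auto simp: abs_mult field_simps)
    finally show "compact {x. e \<le> \<bar>c * f x\<bar>}" .
  qed (intro continuous_intros C0_continuous assms)
qed (simp add: C0_zero)

lemma C0_diff: "f \<in> C0 \<Longrightarrow> g \<in> C0 \<Longrightarrow> (\<lambda>x. f x - g x) \<in> C0"
  using C0_add[of f "\<lambda>x. -1 * g x"] C0_scale[of g "-1"] by simp

lemma C0_approx_closed:
  fixes f :: "'a::topological_space \<Rightarrow> real"
  assumes "\<And>e. 0 < e \<Longrightarrow> \<exists>g\<in>C0. \<forall>x. \<bar>f x - g x\<bar> < e"
  shows "f \<in> C0"
proof -
  have "\<exists>g\<in>C0. \<forall>x. \<bar>f x - g x\<bar> < inverse (Suc n)" for n
    by (rule assms) auto
  then obtain g where g: "\<And>n. g n \<in> C0" "\<And>n x. \<bar>f x - g n x\<bar> < inverse (Suc n)"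
    by metis
  have "uniform_limit UNIV g f sequentially"
    unfolding uniform_limit_iff
  proof safe
    fix e :: real assume "0 < e"
    with LIMSEQ_inverse_real_of_nat have "\<forall>\<^sub>F n in sequentially. inverse (Suc n) < e"
      by (rule order_tendstoD(2))
    then show "\<forall>\<^sub>F n in sequentially. \<forall>x\<in>UNIV. dist (g n x) (f x) < e"
    proof eventually_elim
      case (elim n)
      show ?case
        using less_trans[OF g(2) elim] by (simp add: dist_real_def abs_minus_commute)
    qed
  qed
  then have "continuous_on UNIV f"
    by (rule uniform_limit_theorem[rotated]) (simp_all add: g(1) C0_continuous)
  then show ?thesis
    unfolding C0_def
  proof safe
    fix e :: real assume "0 < e"
    then obtain h where h: "h \<in> C0" "\<And>x. \<bar>f x - h x\<bar> < e/2"
      using assms[of "e/2"] by auto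
    then obtain K where K: "compact K" "\<And>x. x \<notin> K \<Longrightarrow> \<bar>h x\<bar> < e/2"
      using \<open>0 < e\<close> C0_small_outside[OF h(1), of "e/2"] by auto
    have "\<bar>f x\<bar> < e" if "x \<notin> K" for x
      using h(2)[of x] K(2)[OF that] by linarith
    with K(1) show "\<exists>K. compact K \<and> (\<forall>x. x \<notin> K \<longrightarrow> \<bar>f x\<bar> < e)"
      by blast
  qed
qed

text \<open>A Dini-type compactness principle: finitely many members that are small near points of
  \<open>K\<close> cover \<open>K\<close>, and their minimum together with \<open>\<phi>\<close>,
  which handles the complement of \<open>K\<close>, is small everywhere. Closure under minima
  replaces monotonicity of a sequence.\<close>

lemma uniformly_small_member:
  fixes F :: "('a::topological_space \<Rightarrow> real) set"
  assumes cont: "\<And>\<phi>. \<phi> \<in> F \<Longrightarrow> continuous_on UNIV \<phi>"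
    and min: "\<And>\<phi> \<psi>. \<phi> \<in> F \<Longrightarrow> \<psi> \<in> F \<Longrightarrow> (\<lambda>x. min (\<phi> x) (\<psi> x)) \<in> F"
    and \<phi>: "\<phi> \<in> F" "compact K" "\<And>x. x \<notin> K \<Longrightarrow> \<phi> x < e"
    and pointwise: "\<And>x. \<exists>\<psi>\<in>F. \<psi> x < e"
  shows "\<exists>\<psi>\<in>F. \<forall>x. \<psi> x < e"
proof -
  obtain \<Phi> where \<Phi>: "\<And>x. \<Phi> x \<in> F" "\<And>x. \<Phi> x x < e"
    using pointwise by metis
  have "open {y. \<Phi> x y < e}" for x
    using cont[OF \<Phi>(1)] by (intro open_Collect_less continuous_intros)
  moreover have "K \<subseteq> (\<Union>x\<in>K. {y. \<Phi> x y < e})"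
    using \<Phi>(2) by auto
  ultimately obtain C where C: "C \<subseteq> K" "finite C" "K \<subseteq> (\<Union>x\<in>C. {y. \<Phi> x y < e})"
    using compactE_image[OF \<phi>(2)] by metis
  \<comment> \<open>Including \<open>\<phi>\<close> in the minimum both starts the induction, also
    when \<open>C\<close> is empty, and keeps control outside \<open>K\<close>.\<close>
  have "\<exists>\<psi>\<in>F. \<forall>y. \<psi> y \<le> \<phi> y \<and> (\<forall>x\<in>C. \<psi> y \<le> \<Phi> x y)"
    using C(2)
  proof induction
    case empty
    then show ?case using \<phi>(1) by auto
  next
    case (insert x C)
    then obtain \<psi> where "\<psi> \<in> F" "\<forall>y. \<psi> y \<le> \<phi> y \<and> (\<forall>x\<in>C. \<psi> y \<le> \<Phi> x y)"
      by blast
    then show ?case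
      using min[OF _ \<Phi>(1), of \<psi> x] by (intro bexI[of _ "\<lambda>y. min (\<psi> y) (\<Phi> x y)"]) (auto simp: min.coboundedI1)
  qed
  then obtain \<psi> where \<psi>: "\<psi> \<in> F" "\<And>y. \<psi> y \<le> \<phi> y" "\<And>y x. x \<in> C \<Longrightarrow> \<psi> y \<le> \<Phi> x y"
    by blast
  have "\<psi> y < e" for y
  proof (cases "y \<in> K")
    case True
    then obtain x where "x \<in> C" "\<Phi> x y < e" using C(3) by auto
    then show ?thesis using \<psi>(3)[of x y] by simp
  next
    case False
    then show ?thesis using \<psi>(2)[of y] \<phi>(3)[of y] by simp
  qed
  with \<psi>(1) show ?thesis by blast
qed

subsection \<open>Pointwise convergence of resolvents implies uniform convergence\<close>

locale C0_resolvent =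
  fixes R :: "real \<Rightarrow> ('e::topological_space \<Rightarrow> real) \<Rightarrow> ('e \<Rightarrow> real)"
  assumes R_C0: "0 < l \<Longrightarrow> f \<in> C0 \<Longrightarrow> R l f \<in> C0"
    and R_add: "0 < l \<Longrightarrow> f \<in> C0 \<Longrightarrow> g \<in> C0 \<Longrightarrow> R l (\<lambda>x. f x + g x) = (\<lambda>x. R l f x + R l g x)"
    and R_scale: "0 < l \<Longrightarrow> f \<in> C0 \<Longrightarrow> R l (\<lambda>x. c * f x) = (\<lambda>x. c * R l f x)"
    and R_nonneg: "0 < l \<Longrightarrow> f \<in> C0 \<Longrightarrow> (\<And>x. 0 \<le> f x) \<Longrightarrow> 0 \<le> R l f x"
    and R_contraction: "0 < l \<Longrightarrow> f \<in> C0 \<Longrightarrow> (\<And>x. \<bar>f x\<bar> \<le> c) \<Longrightarrow> l * \<bar>R l f x\<bar> \<le> c"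
    and R_identity: "0 < l \<Longrightarrow> 0 < m \<Longrightarrow> f \<in> C0 \<Longrightarrow> R l f x - R m f x = (m - l) * R l (R m f) x"
begin

lemma R_diff:
  "0 < l \<Longrightarrow> f \<in> C0 \<Longrightarrow> g \<in> C0 \<Longrightarrow> R l (\<lambda>x. f x - g x) = (\<lambda>x. R l f x - R l g x)"
  using R_add[of l f "\<lambda>x. -1 * g x"] R_scale[of l g "-1"] C0_scale[of g "-1"] by simp

lemma R_mono:
  assumes "0 < l" "f \<in> C0" "g \<in> C0" "\<And>x. f x \<le> g x"
  shows "R l f x \<le> R l g x"
  using R_nonneg[of l "\<lambda>x. g x - f x" x] R_diff[of l g f] assms by (simp add: C0_diff)

text \<open>Monotonicity cannot be applied to \<open>f \<le> c\<close>, since constants need not lie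
  in \<open>C0\<close>; the positive part of \<open>f\<close> is a majorant inside \<open>C0\<close>
  that is still bounded by \<open>c\<close>.\<close>

lemma R_le:
  assumes "0 < l" "f \<in> C0" "0 \<le> c" "\<And>x. f x \<le> c"
  shows "l * R l f x \<le> c"
proof -
  have C0: "(\<lambda>x. max (f x) 0) \<in> C0"
    by (intro C0_max C0_zero assms)
  have "R l f x \<le> \<bar>R l (\<lambda>x. max (f x) 0) x\<bar>"
    using R_mono[OF assms(1,2) C0, of x] by simp
  then have "l * R l f x \<le> l * \<bar>R l (\<lambda>x. max (f x) 0) x\<bar>"
    using assms(1) by simp
  also have "\<dots> \<le> c"
    by (rule R_contraction[OF assms(1) C0]) (use assms in auto)
  finally show ?thesis .
qed

text \<open>The resolvent identity rewrites the difference as \<open>R l\<close> applied to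
  \<open>m * R m f - f\<close>. Both summands are bounded by \<open>c\<close>, and
  \<open>R l\<close> contributes the factor \<open>1 / l\<close>.\<close>

lemma R_range_rate:
  assumes "0 < l" "0 < m" "f \<in> C0" "\<And>x. \<bar>f x\<bar> \<le> c"
  shows "\<bar>l * R l (R m f) x - R m f x\<bar> \<le> 2 * c / l"
proof -
  have 1: "l * \<bar>R l f x\<bar> \<le> c"
    using assms by (intro R_contraction)
  have "\<bar>m * R m f y\<bar> \<le> c" for y
    using R_contraction[of m f c y] assms by (simp add: abs_mult)
  then have 2: "l * \<bar>R l (\<lambda>y. m * R m f y) x\<bar> \<le> c"
    using assms by (intro R_contraction C0_scale R_C0)
  have "l * R l (R m f) x - R m f x = R l (\<lambda>y. m * R m f y) x - R l f x"
    using R_identity[OF assms(1,2,3), of x] R_scale[of l "R m f" m] assms R_C0[of m f]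
    by (simp add: algebra_simps)
  then have "l * \<bar>l * R l (R m f) x - R m f x\<bar> \<le> l * (\<bar>R l (\<lambda>y. m * R m f y) x\<bar> + \<bar>R l f x\<bar>)"
    using assms(1) by (intro mult_left_mono) auto
  also have "\<dots> \<le> 2 * c"
    using 1 2 by (simp add: distrib_left)
  finally show ?thesis
    using assms(1) by (simp add: field_simps)
qed

section \<open>The closed subspace of uniform convergence\<close>

definition continuity_space :: "('e \<Rightarrow> real) set" where
  "continuity_space = {f \<in> C0. \<forall>e>0. \<forall>\<^sub>F l in at_top. \<forall>x. \<bar>l * R l f x - f x\<bar> < e}"

lemma continuity_spaceD:
  "f \<in> continuity_space \<Longrightarrow> f \<in> C0"
  "f \<in> continuity_space \<Longrightarrow> 0 < e \<Longrightarrow> \<forall>\<^sub>F l in at_top. \<forall>x. \<bar>l * R l f x - f x\<bar> < e"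
  by (auto simp: continuity_space_def)

lemma continuity_space_approx_closed:
  assumes "f \<in> C0" "\<And>e. 0 < e \<Longrightarrow> \<exists>g\<in>continuity_space. \<forall>x. \<bar>f x - g x\<bar> < e"
  shows "f \<in> continuity_space"
  unfolding continuity_space_def
proof (safe intro!: assms(1))
  fix e :: real assume "0 < e"
  then obtain g where g: "g \<in> continuity_space" "\<And>x. \<bar>f x - g x\<bar> < e/3"
    using assms(2)[of "e/3"] by auto
  from continuity_spaceD(2)[OF g(1), of "e/3"] \<open>0 < e\<close>
  have "\<forall>\<^sub>F l in at_top. \<forall>x. \<bar>l * R l g x - g x\<bar> < e/3"
    by simp
  with eventually_gt_at_top[of 0]
  show "\<forall>\<^sub>F l in at_top. \<forall>x. \<bar>l * R l f x - f x\<bar> < e"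
  proof eventually_elim
    case (elim l)
    show ?case
    proof
      fix x
      have gC0: "g \<in> C0" using g(1) by (rule continuity_spaceD)
      have "l * \<bar>R l (\<lambda>x. f x - g x) x\<bar> \<le> e/3"
        using g(2) elim assms(1) gC0 by (intro R_contraction C0_diff) (auto intro: less_imp_le)
      then have "\<bar>l * R l f x - l * R l g x\<bar> \<le> e/3"
        using elim assms(1) gC0
        by (simp add: R_diff abs_mult flip: right_diff_distrib)
      moreover have "\<bar>l * R l g x - g x\<bar> < e/3" "\<bar>f x - g x\<bar> < e/3"
        using elim g(2) by auto
      ultimately show "\<bar>l * R l f x - f x\<bar> < e" by linarith
    qed
  qed
qed

lemma continuity_space_add:
  assumes "f \<in> continuity_space" "g \<in> continuity_space"
  shows "(\<lambda>x. f x + g x) \<in> continuity_space"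
  unfolding continuity_space_def
proof (intro CollectI conjI allI impI C0_add assms[THEN continuity_spaceD(1)])
  fix e :: real assume "0 < e"
  have C0: "f \<in> C0" "g \<in> C0" using assms by (auto dest: continuity_spaceD)
  from \<open>0 < e\<close> have "0 < e/2" by simp
  from continuity_spaceD(2)[OF assms(1) this] continuity_spaceD(2)[OF assms(2) this] eventually_gt_at_top[of 0]
  show "\<forall>\<^sub>F l in at_top. \<forall>x. \<bar>l * R l (\<lambda>x. f x + g x) x - (f x + g x)\<bar> < e"
  proof eventually_elim
    case (elim l)
    show ?case
    proof
      fix x
      have "l * R l (\<lambda>x. f x + g x) x - (f x + g x) = (l * R l f x - f x) + (l * R l g x - g x)"
        using elim C0 by (simp add: R_add algebra_simps)
      moreover have "\<bar>l * R l f x - f x\<bar> < e/2" "\<bar>l * R l g x - g x\<bar> < e/2"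
        using elim by auto
      ultimately show "\<bar>l * R l (\<lambda>x. f x + g x) x - (f x + g x)\<bar> < e"
        by linarith
    qed
  qed
qed

lemma continuity_space_uminus:
  assumes "f \<in> continuity_space"
  shows "(\<lambda>x. - f x) \<in> continuity_space"
  unfolding continuity_space_def
proof safe
  show "(\<lambda>x. - f x) \<in> C0"
    using C0_scale[OF continuity_spaceD(1)[OF assms], of "-1"] by simp
  fix e :: real assume "0 < e"
  from continuity_spaceD(2)[OF assms this] eventually_gt_at_top[of 0]
  show "\<forall>\<^sub>F l in at_top. \<forall>x. \<bar>l * R l (\<lambda>x. - f x) x - - f x\<bar> < e"
  proof eventually_elim
    case (elim l)
    then show ?case
      using R_scale[of l f "-1"] continuity_spaceD(1)[OF assms] by (simp add: abs_minus_commute)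
  qed
qed

text \<open>The rate of \<open>R_range_rate\<close> is uniform in \<open>x\<close>. The factor
  \<open>m\<close> is kept because exactly these functions serve as approximants of \<open>f\<close>
  later; in the proof it is absorbed into \<open>f\<close>.\<close>

lemma continuity_space_scaled_R:
  assumes "0 < m" "f \<in> C0"
  shows "(\<lambda>x. m * R m f x) \<in> continuity_space"
  unfolding continuity_space_def
proof (safe intro!: C0_scale R_C0 assms)
  fix e :: real assume "0 < e"
  obtain c where c: "0 < c" "\<And>x. \<bar>m * f x\<bar> \<le> c"
    using C0_boundedE[OF C0_scale[OF assms(2)]] by metis
  have "((\<lambda>l. 2 * c / l) \<longlongrightarrow> 0) at_top"
    by (intro tendsto_divide_0[OF tendsto_const] filterlim_at_top_imp_at_infinity filterlim_ident)
  from order_tendstoD(2)[OF this \<open>0 < e\<close>] eventually_gt_at_top[of 0]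
  show "\<forall>\<^sub>F l in at_top. \<forall>x. \<bar>l * R l (\<lambda>x. m * R m f x) x - m * R m f x\<bar> < e"
  proof eventually_elim
    case (elim l)
    have "\<bar>l * R l (R m (\<lambda>x. m * f x)) x - R m (\<lambda>x. m * f x) x\<bar> \<le> 2 * c / l" for x
      using elim assms c by (intro R_range_rate C0_scale)
    then have "\<bar>l * R l (R m (\<lambda>x. m * f x)) x - R m (\<lambda>x. m * f x) x\<bar> < e" for x
      using elim(1) by (rule le_less_trans)
    then show ?case
      using assms by (simp add: R_scale)
  qed
qed

end

locale pointwise_continuous_C0_resolvent = C0_resolvent +
  assumes pointwise: "f \<in> C0 \<Longrightarrow> ((\<lambda>l. l * R l f x) \<longlongrightarrow> f x) at_top"
begin

text \<open>For \<open>g = max f 0\<close> the functions \<open>l * R l g\<close> exceed \<open>g\<close> up to a uniformly small error;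
  applying \<open>n * R n\<close> to this inequality shows that they are almost decreasing in \<open>l\<close>,
  so that a Dini argument upgrades pointwise to uniform convergence.\<close>

lemma continuity_space_pos_part:
  assumes f: "f \<in> continuity_space"
  shows "(\<lambda>x. max (f x) 0) \<in> continuity_space"
proof -
  define g where "g = (\<lambda>x. max (f x) 0)"
  have fC0: "f \<in> C0" by (rule continuity_spaceD[OF f])
  then have gC0: "g \<in> C0" unfolding g_def by (intro C0_max C0_zero)
  obtain c where c: "0 < c" "\<And>x. \<bar>g x\<bar> \<le> c"
    using C0_boundedE[OF gC0] by metis
  have "\<forall>\<^sub>F l in at_top. \<forall>x. \<bar>l * R l g x - g x\<bar> < e" if "0 < e" for e
  proof -
    \<comment> \<open>The upper estimate below costs \<open>3 * d\<close>: \<open>2 * d\<close> for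
      the failure of monotonicity and \<open>d\<close> for the Dini step.\<close>
    define d where "d = e/3"
    have d: "0 < d" using that by (simp add: d_def)
    obtain N where N: "\<And>l x. N \<le> l \<Longrightarrow> \<bar>l * R l f x - f x\<bar> < d"
      using continuity_spaceD(2)[OF f d] by (auto simp: eventually_at_top_linorder)
    \<comment> \<open>By positivity \<open>l * R l g\<close> dominates both
      \<open>l * R l f\<close>, which is uniformly close to \<open>f\<close>, and 0; hence it
      dominates \<open>max (f x) 0\<close> up to \<open>d\<close>.\<close>
    have lower: "g x - d \<le> l * R l g x" if "N \<le> l" "0 < l" for l x
    proof -
      have "l * R l f x \<le> l * R l g x" "0 \<le> R l g x"
        using that fC0 gC0 by (auto intro!: R_mono R_nonneg mult_left_mono simp: g_def)
      moreover have "0 \<le> l * R l g x"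
        using \<open>0 \<le> R l g x\<close> that by simp
      ultimately show ?thesis
        using N[OF that(1), of x] d by (auto simp: g_def max_def)
    qed
    have upper: "\<forall>\<^sub>F n in at_top. \<forall>x. n * R n g x \<le> m * R m g x + 2 * d"
      if m: "N \<le> m" "0 < m" for m
    proof -
      \<comment> \<open>This is the rate of \<open>R_range_rate\<close> for the function
        \<open>m * g\<close>, which is bounded by \<open>m * c\<close>; it gives one
        \<open>d\<close>, and the error in \<open>lower\<close> gives the other.\<close>
      have "((\<lambda>n. 2 * (m * c) / n) \<longlongrightarrow> 0) at_top"
        by (intro tendsto_divide_0[OF tendsto_const] filterlim_at_top_imp_at_infinity filterlim_ident)
      from order_tendstoD(2)[OF this d] eventually_gt_at_top[of 0]
      show ?thesis
      proof eventually_elim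
        case (elim n)
        show ?case
        proof
          fix x
          have hC0: "(\<lambda>x. m * g x) \<in> C0" by (intro C0_scale gC0)
          have C0': "R m (\<lambda>x. m * g x) \<in> C0" using m by (intro R_C0 hC0)
          have "n * R n (\<lambda>x. g x - R m (\<lambda>x. m * g x) x) x \<le> d"
          proof (rule R_le)
            show "g x - R m (\<lambda>x. m * g x) x \<le> d" for x
              using lower[OF m, of x] m gC0 by (simp add: R_scale)
          qed (use elim d gC0 C0' in \<open>auto intro!: C0_diff\<close>)
          then have "n * R n g x \<le> n * R n (R m (\<lambda>x. m * g x)) x + d"
            using elim gC0 C0' by (simp add: R_diff right_diff_distrib)
          moreover have "\<bar>n * R n (R m (\<lambda>x. m * g x)) x - R m (\<lambda>x. m * g x) x\<bar> \<le> 2 * (m * c) / n"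
            using elim m hC0 c by (intro R_range_rate) (auto simp: abs_mult)
          ultimately show "n * R n g x \<le> m * R m g x + 2 * d"
            using elim m gC0 by (simp add: R_scale)
        qed
      qed
    qed
    \<comment> \<open>The differences \<open>m * R m g - g\<close> need not be closed under minima.
      The family of all continuous functions that eventually bound them from above, up to
      \<open>2 * d\<close>, is closed and contains those with large \<open>m\<close>.\<close>
    let ?F = "{\<phi>. continuous_on UNIV \<phi> \<and> (\<forall>\<^sub>F n in at_top. \<forall>x. n * R n g x - g x \<le> \<phi> x + 2 * d)}"
    have mem: "(\<lambda>x. m * R m g x - g x) \<in> ?F \<inter> C0" if "N \<le> m" "0 < m" for m
    proof -
      have "(\<lambda>x. m * R m g x - g x) \<in> C0"
        using that by (intro C0_diff C0_scale R_C0 gC0)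
      then show ?thesis
        using upper[OF that] by (auto dest: C0_continuous simp: algebra_simps)
    qed
    have "\<exists>\<psi>\<in>?F. \<forall>x. \<psi> x < d"
    \<comment> \<open>The value \<open>max N 1\<close> is both at least \<open>N\<close> and
      positive, as \<open>mem\<close> requires.\<close>
    proof (rule uniformly_small_member[of ?F "\<lambda>x. max N 1 * R (max N 1) g x - g x"
            "{x. d \<le> \<bar>max N 1 * R (max N 1) g x - g x\<bar>}"])
      show "(\<lambda>x. max N 1 * R (max N 1) g x - g x) \<in> ?F"
        "compact {x. d \<le> \<bar>max N 1 * R (max N 1) g x - g x\<bar>}"
        using mem[of "max N 1"] d by (auto intro: C0_compact_superlevel)
      fix \<phi> \<psi> :: "'a \<Rightarrow> real" assume *: "\<phi> \<in> ?F" "\<psi> \<in> ?F"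
      then have "\<forall>\<^sub>F n in at_top. \<forall>x. n * R n g x - g x \<le> \<phi> x + 2 * d"
        "\<forall>\<^sub>F n in at_top. \<forall>x. n * R n g x - g x \<le> \<psi> x + 2 * d" by auto
      then have "\<forall>\<^sub>F n in at_top. \<forall>x. n * R n g x - g x \<le> min (\<phi> x) (\<psi> x) + 2 * d"
        by eventually_elim (simp add: min_def)
      then show "(\<lambda>x. min (\<phi> x) (\<psi> x)) \<in> ?F"
        using * by (auto intro!: continuous_intros)
    next
      fix x
      have "\<forall>\<^sub>F l in at_top. l * R l g x < g x + d"
        using d by (intro order_tendstoD(2)[OF pointwise[OF gC0]]) auto
      with eventually_ge_at_top[of "max N 1"]
      have "\<forall>\<^sub>F l in at_top. l * R l g x < g x + d \<and> max N 1 \<le> l"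
        by eventually_elim auto
      from eventually_happens'[OF trivial_limit_at_top_linorder this] obtain l where "l * R l g x < g x + d" "max N 1 \<le> l"
        by blast
      then show "\<exists>\<psi>\<in>?F. \<psi> x < d"
        using mem[of l] by (intro bexI[of _ "\<lambda>x. l * R l g x - g x"]) auto
    qed auto
    then obtain \<psi> where \<psi>: "\<And>x. \<psi> x < d"
      "\<forall>\<^sub>F n in at_top. \<forall>x. n * R n g x - g x \<le> \<psi> x + 2 * d" by blast
    from \<psi>(2) eventually_ge_at_top[of "max N 1"]
    show ?thesis
    proof eventually_elim
      case (elim l)
      show ?case
      proof
        fix x
        have "l * R l g x - g x \<le> \<psi> x + 2 * d" "g x - d \<le> l * R l g x"
          using elim lower[of l x] by auto
        then show "\<bar>l * R l g x - g x\<bar> < e"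
          using \<psi>(1)[of x] d by (simp add: d_def abs_if)
      qed
    qed
  qed
  with gC0 show ?thesis
    unfolding continuity_space_def g_def by blast
qed

lemma continuity_space_max:
  assumes "f \<in> continuity_space" "g \<in> continuity_space"
  shows "(\<lambda>x. max (f x) (g x)) \<in> continuity_space"
proof -
  have "(\<lambda>x. max (f x + - g x) 0 + g x) \<in> continuity_space"
    by (intro continuity_space_add continuity_space_uminus continuity_space_pos_part assms)
  also have "(\<lambda>x. max (f x + - g x) 0 + g x) = (\<lambda>x. max (f x) (g x))"
    by (auto simp: max_def)
  finally show ?thesis .
qed

lemma continuity_space_min:
  assumes "f \<in> continuity_space" "g \<in> continuity_space"
  shows "(\<lambda>x. min (f x) (g x)) \<in> continuity_space"
proof -
  have "(\<lambda>x. - max (- f x) (- g x)) \<in> continuity_space"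
    by (intro continuity_space_max continuity_space_uminus assms)
  then show ?thesis by (simp flip: minus_min_eq_max)
qed

text \<open>The lattice form of the Stone-Weierstrass argument. Approximants that are good at two
  prescribed points are available because \<open>l * R l f\<close> converges at both of them.\<close>

lemma nonneg_in_continuity_space:
  assumes f: "f \<in> C0" "\<And>x. 0 \<le> f x"
  shows "f \<in> continuity_space"
proof (rule continuity_space_approx_closed[OF f(1)])
  fix e :: real assume e: "0 < e"
  have contf: "continuous_on UNIV f" using f(1) by (rule C0_continuous)
  have below: "\<exists>g\<in>continuity_space. (\<forall>y. f y - g y < e) \<and> g x < f x + e" for x
  proof -
    \<comment> \<open>Nonnegativity of the members gives \<open>f y - g y < e\<close> wherever
      \<open>f y < e\<close>, hence outside a compact set; the constraint at \<open>x\<close>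
      survives maxima.\<close>
    let ?G = "{g \<in> continuity_space. (\<forall>y. 0 \<le> g y) \<and> g x < f x + e}"
    have good: "(\<lambda>y. l * R l f y) \<in> ?G" if "0 < l" "l * R l f x < f x + e" for l
      using that f R_nonneg[OF that(1) f] by (auto intro!: continuity_space_scaled_R)
    have ev: "\<forall>\<^sub>F l in at_top. l * R l f x < f x + e"
      using e by (intro order_tendstoD(2)[OF pointwise[OF f(1)]]) auto
    from ev eventually_gt_at_top[of 0] have "\<forall>\<^sub>F l in at_top. l * R l f x < f x + e \<and> 0 < l"
      by eventually_elim auto
    from eventually_happens'[OF trivial_limit_at_top_linorder this] obtain l where l: "0 < l" "l * R l f x < f x + e"
      by blast
    have "\<exists>\<psi>\<in>(\<lambda>g y. f y - g y) ` ?G. \<forall>y. \<psi> y < e"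
    proof (rule uniformly_small_member)
      show "continuous_on UNIV \<phi>" if "\<phi> \<in> (\<lambda>g y. f y - g y) ` ?G" for \<phi>
        using that contf by (auto intro!: continuous_intros dest: continuity_spaceD C0_continuous)
    next
      fix \<phi> \<psi> assume "\<phi> \<in> (\<lambda>g y. f y - g y) ` ?G" "\<psi> \<in> (\<lambda>g y. f y - g y) ` ?G"
      then obtain g h where *: "g \<in> ?G" "h \<in> ?G" "\<phi> = (\<lambda>y. f y - g y)" "\<psi> = (\<lambda>y. f y - h y)"
        by blast
      have "(\<lambda>y. max (g y) (h y)) \<in> ?G"
        using * by (auto intro: continuity_space_max simp: le_max_iff_disj)
      moreover have "(\<lambda>y. min (\<phi> y) (\<psi> y)) = (\<lambda>y. f y - max (g y) (h y))"
        unfolding * by (auto simp: min_def max_def)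
      ultimately show "(\<lambda>y. min (\<phi> y) (\<psi> y)) \<in> (\<lambda>g y. f y - g y) ` ?G"
        by (intro image_eqI)
    next
      from good[OF l] show "(\<lambda>y. f y - l * R l f y) \<in> (\<lambda>g y. f y - g y) ` ?G"
        by (intro image_eqI[of _ _ "\<lambda>y. l * R l f y"]) simp_all
      show "compact {y. e \<le> \<bar>f y\<bar>}" by (rule C0_compact_superlevel[OF f(1) e])
      show "f y - l * R l f y < e" if "y \<notin> {y. e \<le> \<bar>f y\<bar>}" for y
      proof -
        have "0 \<le> l * R l f y" using good[OF l] by auto
        with that show ?thesis by auto
      qed
    next
      fix y
      have "\<forall>\<^sub>F l in at_top. f y - e < l * R l f y"
        using e by (intro order_tendstoD(1)[OF pointwise[OF f(1)]]) auto
      with ev eventually_gt_at_top[of 0]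
      have "\<forall>\<^sub>F l in at_top. l * R l f x < f x + e \<and> 0 < l \<and> f y - e < l * R l f y"
        by eventually_elim auto
      from eventually_happens'[OF trivial_limit_at_top_linorder this] obtain l where l: "0 < l" "l * R l f x < f x + e" "f y - e < l * R l f y"
        by blast
      then show "\<exists>\<psi>\<in>(\<lambda>g y. f y - g y) ` ?G. \<psi> y < e"
        using good[OF l(1,2)] by (intro bexI[OF _ imageI]) auto
    qed
    then show ?thesis by blast
  qed
  \<comment> \<open>The second pass varies \<open>x\<close> and takes minima, which preserve the
    lower estimate \<open>f - e\<close>. Outside the compact set where \<open>g0\<close> is at least
    \<open>e\<close> in absolute value, \<open>f \<ge> 0\<close> yields
    \<open>g0 - f < e\<close>.\<close>
  let ?G = "{g \<in> continuity_space. \<forall>y. f y - g y < e}"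
  obtain g0 where g0: "g0 \<in> ?G"
    using below by blast
  have "\<exists>\<psi>\<in>(\<lambda>g y. g y - f y) ` ?G. \<forall>y. \<psi> y < e"
  proof (rule uniformly_small_member)
    show "continuous_on UNIV \<phi>" if "\<phi> \<in> (\<lambda>g y. g y - f y) ` ?G" for \<phi>
      using that contf by (auto intro!: continuous_intros dest: continuity_spaceD C0_continuous)
  next
    fix \<phi> \<psi> assume "\<phi> \<in> (\<lambda>g y. g y - f y) ` ?G" "\<psi> \<in> (\<lambda>g y. g y - f y) ` ?G"
    then obtain g h where *: "g \<in> ?G" "h \<in> ?G" "\<phi> = (\<lambda>y. g y - f y)" "\<psi> = (\<lambda>y. h y - f y)"
      by blast
    have "(\<lambda>y. min (g y) (h y)) \<in> ?G"
      using * by (auto intro!: continuity_space_min) (auto simp: min_def)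
    moreover have "(\<lambda>y. min (\<phi> y) (\<psi> y)) = (\<lambda>y. min (g y) (h y) - f y)"
      unfolding * by (auto simp: min_def)
    ultimately show "(\<lambda>y. min (\<phi> y) (\<psi> y)) \<in> (\<lambda>g y. g y - f y) ` ?G"
      by (intro image_eqI)
  next
    show "(\<lambda>y. g0 y - f y) \<in> (\<lambda>g y. g y - f y) ` ?G"
      using g0 by blast
    show "compact {y. e \<le> \<bar>g0 y\<bar>}"
      using g0 e by (intro C0_compact_superlevel) (auto dest: continuity_spaceD)
    show "g0 y - f y < e" if "y \<notin> {y. e \<le> \<bar>g0 y\<bar>}" for y
      using that f(2)[of y] by auto
  next
    fix x
    obtain g where "g \<in> ?G" "g x < f x + e"
      using below[of x] by blast
    then show "\<exists>\<psi>\<in>(\<lambda>g y. g y - f y) ` ?G. \<psi> x < e"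
      by (intro bexI[OF _ imageI]) auto
  qed
  then obtain g where "g \<in> ?G" "\<forall>y. g y - f y < e" by blast
  then show "\<exists>g\<in>continuity_space. \<forall>x. \<bar>f x - g x\<bar> < e"
    by (intro bexI[of _ g]) (auto simp: abs_less_iff)
qed

text \<open>Positive and negative part are treated separately, because both compactness arguments
  for the approximation use the sign of the function.\<close>

theorem uniform_convergence:
  assumes "f \<in> C0" "0 < e"
  shows "\<forall>\<^sub>F l in at_top. \<forall>x. \<bar>l * R l f x - f x\<bar> < e"
proof -
  have neg: "(\<lambda>x. - f x) \<in> C0"
    using C0_scale[OF assms(1), of "-1"] by simp
  have "(\<lambda>x. max (f x) 0 + - max (- f x) 0) \<in> continuity_space"
    by (intro continuity_space_add continuity_space_uminus nonneg_in_continuity_space)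
      (auto intro!: C0_max C0_zero assms neg)
  also have "(\<lambda>x. max (f x) 0 + - max (- f x) 0) = f"
    by (auto simp: max_def)
  finally show ?thesis
    using assms(2) by (rule continuity_spaceD)
qed

end

subsection \<open>Laplace transforms of bounded functions\<close>

definition laplace :: "(real \<Rightarrow> real) \<Rightarrow> real \<Rightarrow> real" where
  "laplace u l = (LINT t:{0..}|lborel. exp (- l * t) * u t)"

text \<open>The exponential law of rate \<open>l\<close>. Normalising the Laplace kernel to a
  probability measure makes constants integrable and gives contraction bounds at once.\<close>

definition expo :: "real \<Rightarrow> real measure" where
  "expo l = density lborel (exponential_density l)"

lemma prob_space_expo: "0 < l \<Longrightarrow> prob_space (expo l)"
  unfolding expo_def by (rule prob_space_exponential_density)

lemma sets_expo [simp, measurable_cong]: "sets (expo l) = sets borel"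
  by (simp add: expo_def)

lemma space_expo [simp]: "space (expo l) = UNIV"
  by (simp add: expo_def)

lemma integral_expo:
  fixes u :: "real \<Rightarrow> real"
  assumes [measurable]: "u \<in> borel_measurable borel" and l: "0 < l"
  shows "(\<integral>t. u t \<partial>expo l) = (\<integral>t. exponential_density l t * u t \<partial>lborel)"
  unfolding expo_def using l by (subst integral_density) (auto simp: exponential_density_nonneg)

lemma integrable_expo:
  fixes u :: "real \<Rightarrow> real"
  assumes [measurable]: "u \<in> borel_measurable borel" and l: "0 < l" and c: "\<And>t. \<bar>u t\<bar> \<le> c"
  shows "integrable (expo l) u"
proof -
  interpret prob_space "expo l" by (rule prob_space_expo[OF l])
  show ?thesis
    by (rule integrable_const_bound[of _ c]) (use c in auto)
qed

lemma laplace_eq_expo: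
  assumes [measurable]: "u \<in> borel_measurable borel" and l: "0 < l"
  shows "l * laplace u l = (\<integral>t. u t \<partial>expo l)"
proof -
  have "l * laplace u l = (\<integral>t. l * (indicator {0..} t *\<^sub>R (exp (- l * t) * u t)) \<partial>lborel)"
    unfolding laplace_def set_lebesgue_integral_def by simp
  also have "\<dots> = (\<integral>t. exponential_density l t * u t \<partial>lborel)"
    by (intro Bochner_Integration.integral_cong)
      (auto simp: exponential_density_def indicator_def mult_ac)
  finally show ?thesis
    using assms by (simp add: integral_expo)
qed

lemma laplace_cong: "(\<And>t. 0 \<le> t \<Longrightarrow> u t = v t) \<Longrightarrow> laplace u l = laplace v l"
  unfolding laplace_def by (intro set_lebesgue_integral_cong) auto

lemma set_integrable_laplace:
  fixes u :: "real \<Rightarrow> real"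
  assumes [measurable]: "u \<in> borel_measurable borel" and l: "0 < l" and c: "\<And>t. \<bar>u t\<bar> \<le> c"
  shows "set_integrable lborel {0..} (\<lambda>t. exp (- l * t) * u t)"
proof -
  have "integrable lborel (\<lambda>t. exponential_density l t *\<^sub>R u t)"
    using integrable_expo[OF assms] l unfolding expo_def
    by (subst (asm) integrable_density) (auto simp: exponential_density_nonneg)
  then have "integrable lborel (\<lambda>t. (1/l) * (exponential_density l t *\<^sub>R u t))"
    by (rule integrable_mult_right)
  also have "(\<lambda>t. (1/l) * (exponential_density l t *\<^sub>R u t)) = (\<lambda>t. indicator {0..} t *\<^sub>R (exp (- l * t) * u t))"
    using l by (auto simp: exponential_density_def indicator_def mult_ac)
  finally show ?thesis
    unfolding set_integrable_def .
qed

lemma laplace_bound: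
  fixes u :: "real \<Rightarrow> real"
  assumes [measurable]: "u \<in> borel_measurable borel" and l: "0 < l" and c: "\<And>t. \<bar>u t\<bar> \<le> c"
  shows "\<bar>laplace u l\<bar> \<le> c / l"
proof -
  interpret prob_space "expo l" by (rule prob_space_expo[OF l])
  have "\<bar>\<integral>t. u t \<partial>expo l\<bar> \<le> (\<integral>t. \<bar>u t\<bar> \<partial>expo l)"
    by (rule integral_abs_bound)
  also have "\<dots> \<le> (\<integral>t. c \<partial>expo l)"
    using c by (intro integral_mono integrable_abs integrable_expo l) auto
  also have "\<dots> = c"
    by (simp add: prob_space[unfolded space_expo])
  finally have "\<bar>l * laplace u l\<bar> \<le> c"
    using l by (simp add: laplace_eq_expo)
  then show ?thesis
    using l by (simp add: abs_mult field_simps)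
qed

lemma laplace_scale: "laplace (\<lambda>t. a * u t) l = a * laplace u l"
  unfolding laplace_def by (simp add: mult.left_commute)

lemma laplace_shift:
  assumes "0 \<le> s"
  shows "laplace (\<lambda>t. u (t + s)) m = exp (m * s) * (LINT r:{s..}|lborel. exp (- m * r) * u r)"
proof -
  have "(LINT r:{s..}|lborel. exp (- m * r) * u r)
      = (\<integral>t. indicator {s..} (s + 1 * t) *\<^sub>R (exp (- m * (s + 1 * t)) * u (s + 1 * t)) \<partial>lborel)"
    unfolding set_lebesgue_integral_def by (subst lborel_integral_real_affine[of 1 _ s]) auto
  also have "\<dots> = (\<integral>t. exp (- m * s) * (indicator {0..} t *\<^sub>R (exp (- m * t) * u (t + s))) \<partial>lborel)"
  proof (intro Bochner_Integration.integral_cong refl)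
    fix t
    have "exp (- m * (s + 1 * t)) = exp (- m * s) * exp (- m * t)"
      by (simp add: distrib_left flip: exp_add)
    then show "indicator {s..} (s + 1 * t) *\<^sub>R (exp (- m * (s + 1 * t)) * u (s + 1 * t))
        = exp (- m * s) * (indicator {0..} t *\<^sub>R (exp (- m * t) * u (t + s)))"
      by (simp add: indicator_def add.commute)
  qed
  also have "\<dots> = exp (- m * s) * laplace (\<lambda>t. u (t + s)) m"
    unfolding laplace_def set_lebesgue_integral_def by simp
  finally show ?thesis
    by (simp add: exp_minus field_simps)
qed

text \<open>The factor \<open>a\<close> stays on the left so that \<open>a = 0\<close> is covered;
  in the resolvent identity \<open>a\<close> is \<open>m - l\<close>, which may vanish.\<close>

lemma LINT_exp_Icc:
  assumes "0 \<le> (r::real)"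
  shows "a * (LINT s:{0..r}|lborel. exp (a * s)) = exp (a * r) - 1"
proof -
  have "(\<integral>s. indicator {0..r} s *\<^sub>R (a * exp (a * s)) \<partial>lborel) = exp (a * r) - exp (a * 0)"
    using assms
    by (intro integral_FTC_atLeastAtMost)
      (auto intro!: derivative_eq_intros continuous_intros simp flip: has_real_derivative_iff_has_vector_derivative)
  then show ?thesis
    unfolding set_lebesgue_integral_def by (simp add: mult.left_commute)
qed

text \<open>Substituting \<open>r = t + s\<close> turns the iterated transform into an integral over
  the wedge where \<open>0 \<le> s \<le> r\<close>. Integrating over \<open>s\<close> first leaves
  an elementary exponential integral, whose two endpoints give the two transforms on the
  right.\<close>

theorem laplace_resolvent_identity:
  fixes u :: "real \<Rightarrow> real"
  assumes u [measurable]: "u \<in> borel_measurable borel"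
    and c: "\<And>t. \<bar>u t\<bar> \<le> c" and l: "0 < l" and m: "0 < m"
  shows "(m - l) * laplace (\<lambda>s. laplace (\<lambda>t. u (t + s)) m) l = laplace u l - laplace u m"
proof -
  \<comment> \<open>The factor \<open>exp (m * s)\<close> produced by the shift is merged with the
    outer kernel \<open>exp (- l * s)\<close>.\<close>
  define K where
    "K s r = (if 0 \<le> s \<and> s \<le> r then exp ((m - l) * s) * (exp (- m * r) * u r) else 0)" for s r
  have K_meas [measurable]: "case_prod K \<in> borel_measurable (lborel \<Otimes>\<^sub>M lborel)"
    unfolding K_def split_beta' by measurable
  have exp_split: "exp ((m - l) * s) = exp (- l * s) * exp (m * s)" for s
    by (simp add: left_diff_distrib flip: exp_add)
  have inner: "(\<integral>r. K s r \<partial>lborel) = indicator {0..} s *\<^sub>R (exp (- l * s) * laplace (\<lambda>t. u (t + s)) m)" for s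
  proof (cases "0 \<le> s")
    case True
    have "(\<integral>r. K s r \<partial>lborel)
        = (\<integral>r. exp ((m - l) * s) * (indicator {s..} r *\<^sub>R (exp (- m * r) * u r)) \<partial>lborel)"
      using True by (intro Bochner_Integration.integral_cong) (auto simp: K_def indicator_def)
    also have "\<dots> = exp (- l * s) * (exp (m * s) * (LINT r:{s..}|lborel. exp (- m * r) * u r))"
      unfolding set_lebesgue_integral_def exp_split by (simp add: mult.assoc)
    finally show ?thesis
      using True laplace_shift[OF True, of u m] by simp
  qed (simp add: K_def)
  have norm_inner: "(\<integral>r. norm (K s r) \<partial>lborel)
      = indicator {0..} s *\<^sub>R (exp (- l * s) * laplace (\<lambda>t. \<bar>u (t + s)\<bar>) m)" for s
  proof (cases "0 \<le> s")
    case True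
    have "(\<integral>r. norm (K s r) \<partial>lborel)
        = (\<integral>r. exp ((m - l) * s) * (indicator {s..} r *\<^sub>R (exp (- m * r) * \<bar>u r\<bar>)) \<partial>lborel)"
      using True by (intro Bochner_Integration.integral_cong) (auto simp: K_def indicator_def abs_mult)
    also have "\<dots> = exp (- l * s) * (exp (m * s) * (LINT r:{s..}|lborel. exp (- m * r) * \<bar>u r\<bar>))"
      unfolding set_lebesgue_integral_def exp_split by (simp add: mult.assoc)
    finally show ?thesis
      using True laplace_shift[OF True, of "\<lambda>t. \<bar>u t\<bar>" m] by simp
  qed (simp add: K_def)
  \<comment> \<open>The inner absolute integral is at most \<open>exp (- l * s) * (c / m)\<close>
    for \<open>s \<ge> 0\<close>, which is integrable in \<open>s\<close>.\<close>
  have Kint: "integrable (lborel \<Otimes>\<^sub>M lborel) (case_prod K)"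
  proof (rule lborel_pair.Fubini_integrable)
    have "integrable lborel (\<lambda>s. indicator {0..} s *\<^sub>R (exp (- l * s) * (c / m)))"
      using set_integrable_laplace[of "\<lambda>_. c / m" l "\<bar>c / m\<bar>"] l by (simp add: set_integrable_def)
    then have "integrable lborel (\<lambda>s. \<integral>r. norm (K s r) \<partial>lborel)"
    proof (rule Bochner_Integration.integrable_bound)
      show "(\<lambda>s. \<integral>r. norm (K s r) \<partial>lborel) \<in> borel_measurable lborel"
        by measurable
      have "\<bar>laplace (\<lambda>t. \<bar>u (t + s)\<bar>) m\<bar> \<le> c / m" for s
        using c m by (intro laplace_bound) auto
      then show "AE s in lborel. norm (\<integral>r. norm (K s r) \<partial>lborel)
          \<le> norm (indicator {0..} s *\<^sub>R (exp (- l * s) * (c / m)))"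
        unfolding norm_inner
        by (intro AE_I2) (auto simp: indicator_def abs_mult simp del: abs_divide intro!: mult_left_mono
            simp flip: abs_divide times_divide_eq_right intro: order_trans[OF _ abs_ge_self])
    qed
    then show "integrable lborel (\<lambda>s. \<integral>r. norm (case_prod K (s, r)) \<partial>lborel)"
      by simp
    show "AE s in lborel. integrable lborel (\<lambda>r. case_prod K (s, r))"
    proof (rule AE_I2)
      fix s
      have "integrable lborel (\<lambda>r. exp ((m - l) * s) *
          (indicator {s..} r *\<^sub>R (indicator {0..} r *\<^sub>R (exp (- m * r) * u r))))"
        using set_integrable_laplace[OF u m c] unfolding set_integrable_def
        by (rule integrable_mult_right[OF integrable_mult_indicator, rotated]) simp
      then have "integrable lborel (\<lambda>r. indicator {0..} s *\<^sub>R (exp ((m - l) * s) *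
          (indicator {s..} r *\<^sub>R (indicator {0..} r *\<^sub>R (exp (- m * r) * u r)))))"
        by (rule integrable_scaleR_right)
      also have "(\<lambda>r. indicator {0..} s *\<^sub>R (exp ((m - l) * s) *
          (indicator {s..} r *\<^sub>R (indicator {0..} r *\<^sub>R (exp (- m * r) * u r))))) = K s"
        by (auto simp: K_def indicator_def)
      finally show "integrable lborel (\<lambda>r. case_prod K (s, r))" by simp
    qed
  qed measurable
  have outer: "(m - l) * (\<integral>s. K s r \<partial>lborel)
      = indicator {0..} r *\<^sub>R (exp (- l * r) * u r) - indicator {0..} r *\<^sub>R (exp (- m * r) * u r)" for r
  proof (cases "0 \<le> r")
    case True
    have "(\<integral>s. K s r \<partial>lborel) = (\<integral>s. (exp (- m * r) * u r) * (indicator {0..r} s *\<^sub>R exp ((m - l) * s)) \<partial>lborel)"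
      by (intro Bochner_Integration.integral_cong) (auto simp: K_def indicator_def)
    also have "\<dots> = (exp (- m * r) * u r) * (LINT s:{0..r}|lborel. exp ((m - l) * s))"
      by (simp add: set_lebesgue_integral_def)
    finally have "(m - l) * (\<integral>s. K s r \<partial>lborel) = (exp (- m * r) * u r) * (exp ((m - l) * r) - 1)"
      using LINT_exp_Icc[OF True, of "m - l"] by (simp add: mult_ac)
    also have "\<dots> = exp (- l * r) * u r - exp (- m * r) * u r"
      unfolding exp_split[of r] by (simp add: algebra_simps flip: exp_add)
    finally show ?thesis using True by simp
  next
    case False
    then have "K s r = 0" for s by (simp add: K_def)
    with False show ?thesis by simp
  qed
  have "(m - l) * laplace (\<lambda>s. laplace (\<lambda>t. u (t + s)) m) l = (m - l) * (\<integral>s. (\<integral>r. K s r \<partial>lborel) \<partial>lborel)"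
    unfolding inner by (simp add: laplace_def set_lebesgue_integral_def)
  also have "\<dots> = (m - l) * (\<integral>r. (\<integral>s. K s r \<partial>lborel) \<partial>lborel)"
    using lborel_pair.Fubini_integral[OF Kint] by simp
  also have "\<dots> = (\<integral>r. (m - l) * (\<integral>s. K s r \<partial>lborel) \<partial>lborel)"
    by simp
  also have "\<dots> = laplace u l - laplace u m"
    unfolding outer laplace_def set_lebesgue_integral_def
    using set_integrable_laplace[OF u m c] set_integrable_laplace[OF u l c]
    by (intro Bochner_Integration.integral_diff) (auto simp: set_integrable_def)
  finally show ?thesis .
qed

text \<open>A rate-1 exponential time divided by \<open>l\<close> has rate \<open>l\<close>. Moving
  \<open>l\<close> from the measure into the integrand prepares dominated convergence as
  \<open>l\<close> grows.\<close>

lemma expo_rescale: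
  fixes u :: "real \<Rightarrow> real"
  assumes [measurable]: "u \<in> borel_measurable borel" and l: "0 < l"
  shows "(\<integral>t. u t \<partial>expo l) = (\<integral>t. u (t / l) \<partial>expo 1)"
proof -
  have "(\<integral>t. u t \<partial>expo l) = (\<integral>t. exponential_density l t * u t \<partial>lborel)"
    using l by (simp add: integral_expo)
  also have "\<dots> = \<bar>1 / l\<bar> *\<^sub>R (\<integral>t. exponential_density l (0 + (1 / l) * t) * u (0 + (1 / l) * t) \<partial>lborel)"
    using l by (intro lborel_integral_real_affine) auto
  also have "\<dots> = (\<integral>t. (1 / l) * (exponential_density l (t / l) * u (t / l)) \<partial>lborel)"
    using l by simp
  also have "\<dots> = (\<integral>t. exponential_density 1 t * u (t / l) \<partial>lborel)"
    using l by (intro Bochner_Integration.integral_cong)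
      (auto simp: exponential_density_def divide_less_0_iff)
  also have "\<dots> = (\<integral>t. u (t / l) \<partial>expo 1)"
    by (simp add: integral_expo)
  finally show ?thesis .
qed

text \<open>Exponential times of rate \<open>l\<close> concentrate at 0, where \<open>u\<close> has
  right limit \<open>a\<close>. Prescribing \<open>u = a\<close> on nonpositive times makes the
  integrands converge for every \<open>t\<close>; it holds for \<open>U (max 0 t) f x\<close>
  because \<open>U 0 f = f\<close>.\<close>

lemma scaled_laplace_tendsto:
  fixes u :: "real \<Rightarrow> real"
  assumes [measurable]: "u \<in> borel_measurable borel" and c: "\<And>t. \<bar>u t\<bar> \<le> c"
    and neg: "\<And>t. t \<le> 0 \<Longrightarrow> u t = a" and lim: "(u \<longlongrightarrow> a) (at_right 0)"
  shows "((\<lambda>l. l * laplace u l) \<longlongrightarrow> a) at_top"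
proof -
  interpret prob_space "expo 1" by (rule prob_space_expo) simp
  have "((\<lambda>l. \<integral>t. u (t / l) \<partial>expo 1) \<longlongrightarrow> (\<integral>t. a \<partial>expo 1)) at_top"
  proof (rule integral_dominated_convergence_at_top[where w = "\<lambda>_. c"])
    show "AE t in expo 1. ((\<lambda>l. u (t / l)) \<longlongrightarrow> a) at_top"
    proof (rule AE_I2)
      fix t :: real
      show "((\<lambda>l. u (t / l)) \<longlongrightarrow> a) at_top"
      proof (cases "0 < t")
        case True
        have "filterlim (\<lambda>l. t / l) (at_right 0) at_top"
          unfolding filterlim_at
        proof
          show "\<forall>\<^sub>F l in at_top. t / l \<in> {0<..} \<and> t / l \<noteq> 0"
            using eventually_gt_at_top[of 0] by eventually_elim (use True in simp)
          show "((\<lambda>l. t / l) \<longlongrightarrow> 0) at_top"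
            by (intro tendsto_divide_0[OF tendsto_const] filterlim_at_top_imp_at_infinity filterlim_ident)
        qed
        with lim show ?thesis by (rule filterlim_compose)
      next
        case False
        from eventually_gt_at_top[of "0::real"] have "\<forall>\<^sub>F l in at_top. u (t / l) = a"
          by eventually_elim (use False in \<open>simp add: neg divide_nonpos_pos\<close>)
        then show ?thesis by (rule tendsto_eventually)
      qed
    qed
  qed (use c in auto)
  also have "(\<integral>t. a \<partial>expo 1) = a"
    by (simp add: prob_space[unfolded space_expo])
  finally have "((\<lambda>l. \<integral>t. u (t / l) \<partial>expo 1) \<longlongrightarrow> a) at_top" .
  moreover have "\<forall>\<^sub>F l in at_top. (\<integral>t. u (t / l) \<partial>expo 1) = l * laplace u l"
    using eventually_gt_at_top[of 0]
    by eventually_elim (simp add: laplace_eq_expo expo_rescale[of u])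
  ultimately show ?thesis
    by (rule Lim_transform_eventually)
qed

subsection \<open>Semigroup and resolvent of a Markov process\<close>

lemma bounded_borelI:
  "f \<in> borel_measurable borel \<Longrightarrow> (\<And>x. \<bar>f x\<bar> \<le> c) \<Longrightarrow> f \<in> bounded_borel"
  by (auto simp: bounded_borel_def bounded_iff)

lemma bounded_borelE:
  assumes "f \<in> bounded_borel"
  obtains c where "0 < c" "\<And>x. \<bar>f x\<bar> \<le> c"
  using assms by (auto simp: bounded_borel_def bounded_pos)

lemma bounded_borel_measurable: "f \<in> bounded_borel \<Longrightarrow> f \<in> borel_measurable borel"
  by (simp add: bounded_borel_def)

lemma bounded_borel_add:
  assumes "f \<in> bounded_borel" "g \<in> bounded_borel"
  shows "(\<lambda>x. f x + g x) \<in> bounded_borel"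
proof -
  obtain a b where "\<And>x. \<bar>f x\<bar> \<le> a" "\<And>x. \<bar>g x\<bar> \<le> b"
    using assms by (metis bounded_borelE)
  then have "\<bar>f x + g x\<bar> \<le> a + b" for x
    by (meson abs_triangle_ineq add_mono order_trans)
  then show ?thesis
    using assms[THEN bounded_borel_measurable] by (intro bounded_borelI) auto
qed

lemma bounded_borel_scale:
  assumes "f \<in> bounded_borel"
  shows "(\<lambda>x. a * f x) \<in> bounded_borel"
proof -
  obtain c where "\<And>x. \<bar>f x\<bar> \<le> c"
    using assms by (metis bounded_borelE)
  then have "\<bar>a * f x\<bar> \<le> \<bar>a\<bar> * c" for x
    by (simp add: abs_mult mult_left_mono)
  then show ?thesis
    using assms[THEN bounded_borel_measurable] by (intro bounded_borelI) auto
qed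

lemma bounded_borel_diff:
  "f \<in> bounded_borel \<Longrightarrow> g \<in> bounded_borel \<Longrightarrow> (\<lambda>x. f x - g x) \<in> bounded_borel"
  using bounded_borel_add[of f "\<lambda>x. -1 * g x"] bounded_borel_scale[of g "-1"] by simp

lemma C0_bounded_borel: "f \<in> C0 \<Longrightarrow> f \<in> bounded_borel"
  using C0_subset_bounded_borel by blast

text \<open>This is what allows \<open>real_cond_exp\<close> in the Markov property to be handled as
  a genuine conditional expectation.\<close>

lemma subalgebra_past_algebra:
  assumes "\<And>r. 0 \<le> r \<Longrightarrow> X r \<in> measurable A borel" "sets M = sets A"
  shows "subalgebra M (past_algebra A X s)"
proof -
  have gen: "{X r -` B \<inter> space A | r B. 0 \<le> r \<and> r \<le> s \<and> B \<in> sets borel} \<subseteq> sets A"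
    using assms(1) by (auto intro: measurable_sets)
  then have "{X r -` B \<inter> space A | r B. 0 \<le> r \<and> r \<le> s \<and> B \<in> sets borel} \<subseteq> Pow (space A)"
    using sets.space_closed by blast
  then have "sets (past_algebra A X s) \<subseteq> sets A" "space (past_algebra A X s) = space A"
    unfolding past_algebra_def using gen by (auto simp: sets.sigma_sets_subset space_measure_of_conv dest: subsetD[OF sets.sigma_sets_subset])
  then show ?thesis
    unfolding subalgebra_def using sets_eq_imp_space_eq[OF assms(2)] assms(2) by simp
qed

text \<open>Joint measurability makes \<open>R l f\<close> a Borel function and permits Fubini
  between \<open>P x\<close> and the time integral.\<close>

locale measurable_markov_process = markov_process A X P
  for A :: "'w measure" and X :: "real \<Rightarrow> 'w \<Rightarrow> 'e::metric_space" and P :: "'e \<Rightarrow> 'w measure" +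
  assumes transition_measurable: "f \<in> bounded_borel \<Longrightarrow>
      (\<lambda>(t, x). \<integral>\<omega>. f (X t \<omega>) \<partial>P x) \<in> borel_measurable (restrict_space borel {0..} \<Otimes>\<^sub>M borel)"
begin

abbreviation "U \<equiv> semigroup_of P X"

abbreviation "R \<equiv> resolvent_of P X"

lemma X_measurable: "0 \<le> t \<Longrightarrow> X t \<in> measurable (P x) borel"
  using random_variables measurable_cong_sets[OF sets_P refl] by blast

lemma X_integrable:
  assumes f: "f \<in> bounded_borel" and t: "0 \<le> t"
  shows "integrable (P x) (\<lambda>\<omega>. f (X t \<omega>))"
proof -
  interpret prob_space "P x" by (rule prob_P)
  obtain c where "\<And>x. \<bar>f x\<bar> \<le> c" using bounded_borelE[OF f] by metis
  then show ?thesis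
    using measurable_compose[OF X_measurable[OF t] bounded_borel_measurable[OF f]]
    by (intro integrable_const_bound[of _ c]) auto
qed

lemma U_bound:
  assumes "f \<in> bounded_borel" "0 \<le> t" "\<And>x. \<bar>f x\<bar> \<le> c"
  shows "\<bar>U t f x\<bar> \<le> c"
proof -
  interpret prob_space "P x" by (rule prob_P)
  have "\<bar>U t f x\<bar> \<le> (\<integral>\<omega>. \<bar>f (X t \<omega>)\<bar> \<partial>P x)"
    unfolding semigroup_of_def by (rule integral_abs_bound)
  also have "\<dots> \<le> (\<integral>\<omega>. c \<partial>P x)"
    using assms by (intro integral_mono integrable_abs X_integrable assms(1) integrable_const) auto
  finally show ?thesis by (simp add: prob_space)
qed

text \<open>Freezing negative times at 0 extends the semigroup measurably to the whole line, so that
  the Laplace lemmas, which speak of functions on all of \<open>real\<close>, apply.\<close>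

lemma U_jointly_measurable:
  assumes "f \<in> bounded_borel"
  shows "(\<lambda>(t, x). U (max 0 t) f x) \<in> borel_measurable (borel \<Otimes>\<^sub>M borel)"
proof -
  have "(\<lambda>p::real \<times> 'e. (max 0 (fst p), snd p)) \<in> borel \<Otimes>\<^sub>M borel \<rightarrow>\<^sub>M restrict_space borel {0..} \<Otimes>\<^sub>M borel"
    by (intro measurable_Pair measurable_restrict_space2) auto
  from measurable_compose[OF this transition_measurable[OF assms]] show ?thesis
    by (simp add: semigroup_of_def split_beta')
qed

lemma U_time_measurable:
  "f \<in> bounded_borel \<Longrightarrow> (\<lambda>t. U (max 0 t) f x) \<in> borel_measurable borel"
  using measurable_compose[OF measurable_Pair2' U_jointly_measurable] by simp

lemma U_bounded_borel:
  assumes f: "f \<in> bounded_borel" and t: "0 \<le> t"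
  shows "U t f \<in> bounded_borel"
proof -
  obtain c where c: "\<And>x. \<bar>f x\<bar> \<le> c" using bounded_borelE[OF f] by metis
  have "(\<lambda>x. U (max 0 t) f x) \<in> borel_measurable borel"
    using measurable_compose[OF measurable_Pair1' U_jointly_measurable[OF f]] by simp
  then show ?thesis
    using U_bound[OF f t c] t by (intro bounded_borelI[of _ c]) (auto simp: max_def)
qed

lemma U_add:
  "f \<in> bounded_borel \<Longrightarrow> g \<in> bounded_borel \<Longrightarrow> 0 \<le> t \<Longrightarrow> U t (\<lambda>x. f x + g x) x = U t f x + U t g x"
  unfolding semigroup_of_def by (intro Bochner_Integration.integral_add X_integrable)

lemma U_scale: "U t (\<lambda>x. a * f x) x = a * U t f x"
  unfolding semigroup_of_def by simp

lemma U_diff: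
  "f \<in> bounded_borel \<Longrightarrow> g \<in> bounded_borel \<Longrightarrow> 0 \<le> t \<Longrightarrow> U t (\<lambda>x. f x - g x) x = U t f x - U t g x"
  unfolding semigroup_of_def by (intro Bochner_Integration.integral_diff X_integrable)

lemma U_nonneg: "(\<And>x. 0 \<le> f x) \<Longrightarrow> 0 \<le> U t f x"
  unfolding semigroup_of_def by (rule Bochner_Integration.integral_nonneg) auto

lemma U_0:
  assumes "f \<in> bounded_borel"
  shows "U 0 f = f"
proof
  fix x
  interpret prob_space "P x" by (rule prob_P)
  have "U 0 f x = (\<integral>\<omega>. f x \<partial>P x)"
    unfolding semigroup_of_def
  proof (rule integral_cong_AE)
    show "AE \<omega> in P x. f (X 0 \<omega>) = f x"
      using start[of x] by eventually_elim simp
  qed (use X_integrable[OF assms, of 0 x] in auto)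
  then show "U 0 f x = f x" by (simp add: prob_space)
qed

text \<open>Integrating the Markov property at time \<open>s\<close> removes the conditional
  expectation; this is why the composition appears in the order \<open>U s (U t f)\<close>.\<close>

lemma U_semigroup:
  assumes f: "f \<in> bounded_borel" and s: "0 \<le> s" and t: "0 \<le> t"
  shows "U (t + s) f = U s (U t f)"
proof
  fix x
  interpret prob_space "P x" by (rule prob_P)
  interpret finite_measure_subalgebra "P x" "past_algebra A X s"
    by unfold_locales (intro subalgebra_past_algebra random_variables sets_P)
  have int: "integrable (P x) (\<lambda>\<omega>. f (X (t + s) \<omega>))"
    using s t by (intro X_integrable f) auto
  have "U (t + s) f x = (\<integral>\<omega>. real_cond_exp (P x) (past_algebra A X s) (\<lambda>\<omega>'. f (X (t + s) \<omega>')) \<omega> \<partial>P x)"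
    unfolding semigroup_of_def using real_cond_exp_int(2)[OF int] by simp
  also have "\<dots> = (\<integral>\<omega>. U t f (X s \<omega>) \<partial>P x)"
  proof (rule integral_cong_AE)
    show "AE \<omega> in P x. real_cond_exp (P x) (past_algebra A X s) (\<lambda>\<omega>'. f (X (t + s) \<omega>')) \<omega> = U t f (X s \<omega>)"
      unfolding semigroup_of_def by (rule markov_property[OF f s t])
    show "(\<lambda>\<omega>. U t f (X s \<omega>)) \<in> borel_measurable (P x)"
      using X_integrable[OF U_bounded_borel[OF f t] s] by auto
  qed (use real_cond_exp_int(1)[OF int] in auto)
  finally show "U (t + s) f x = U s (U t f) x"
    by (simp add: semigroup_of_def)
qed

section \<open>The resolvent as a Laplace transform of the semigroup\<close>

lemma R_laplace: "R l f x = laplace (\<lambda>t. U (max 0 t) f x) l"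
  unfolding resolvent_of_def laplace_def by (intro set_lebesgue_integral_cong) auto

lemma R_expo:
  "f \<in> bounded_borel \<Longrightarrow> 0 < l \<Longrightarrow> l * R l f x = (\<integral>t. U (max 0 t) f x \<partial>expo l)"
  unfolding R_laplace by (intro laplace_eq_expo U_time_measurable)

lemma U_time_integrable:
  assumes f: "f \<in> bounded_borel" and l: "0 < l"
  shows "integrable (expo l) (\<lambda>t. U (max 0 t) f x)"
proof -
  obtain c where "\<And>x. \<bar>f x\<bar> \<le> c" using bounded_borelE[OF f] by metis
  then show ?thesis
    using U_bound[OF f] by (intro integrable_expo[of _ _ c] U_time_measurable f l) auto
qed

lemma R_bound:
  assumes "f \<in> bounded_borel" "0 < l" "\<And>x. \<bar>f x\<bar> \<le> c"
  shows "\<bar>R l f x\<bar> \<le> c / l"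
  unfolding R_laplace
  using assms by (intro laplace_bound U_time_measurable U_bound) auto

lemma R_bounded_borel:
  assumes f: "f \<in> bounded_borel" and l: "0 < l"
  shows "R l f \<in> bounded_borel"
proof -
  interpret prob_space "expo l" by (rule prob_space_expo[OF l])
  obtain c where c: "\<And>x. \<bar>f x\<bar> \<le> c" using bounded_borelE[OF f] by metis
  have "(\<lambda>p::'e \<times> real. (snd p, fst p)) \<in> borel \<Otimes>\<^sub>M expo l \<rightarrow>\<^sub>M borel \<Otimes>\<^sub>M borel"
    by measurable
  from measurable_compose[OF this U_jointly_measurable[OF f]]
  have "(\<lambda>(x, t). U (max 0 t) f x) \<in> borel_measurable (borel \<Otimes>\<^sub>M expo l)"
    by (simp add: split_beta')
  then have "(\<lambda>x. (\<integral>t. U (max 0 t) f x \<partial>expo l) / l) \<in> borel_measurable borel"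
    by (intro borel_measurable_divide borel_measurable_lebesgue_integral) auto
  also have "(\<lambda>x. (\<integral>t. U (max 0 t) f x \<partial>expo l) / l) = R l f"
    using l by (simp flip: R_expo[OF f l])
  finally show ?thesis
    using R_bound[OF f l c] by (rule bounded_borelI)
qed

lemma R_add:
  assumes "f \<in> bounded_borel" "g \<in> bounded_borel" "0 < l"
  shows "R l (\<lambda>x. f x + g x) x = R l f x + R l g x"
proof -
  have "l * R l (\<lambda>x. f x + g x) x = l * R l f x + l * R l g x"
    using assms
    by (simp add: R_expo bounded_borel_add U_add U_time_integrable)
  with assms(3) show ?thesis by (simp flip: distrib_left)
qed

lemma R_scale: "R l (\<lambda>x. a * f x) x = a * R l f x"
  unfolding R_laplace U_scale by (rule laplace_scale)

lemma R_diff: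
  "f \<in> bounded_borel \<Longrightarrow> g \<in> bounded_borel \<Longrightarrow> 0 < l \<Longrightarrow> R l (\<lambda>x. f x - g x) x = R l f x - R l g x"
  using R_add[of f "\<lambda>x. -1 * g x" l x] bounded_borel_scale[of g "-1"] R_scale[of l "-1" g x] by simp

lemma R_nonneg: "(\<And>x. 0 \<le> f x) \<Longrightarrow> 0 \<le> R l f x"
  unfolding resolvent_of_def set_lebesgue_integral_def
  by (intro Bochner_Integration.integral_nonneg) (simp add: U_nonneg)

text \<open>Fubini on \<open>P x\<close> and \<open>expo l\<close> moves \<open>U s\<close> under
  the time integral, where both orders of composition with \<open>U t\<close> equal
  \<open>U (t + s)\<close>.\<close>

lemma U_R_commute:
  assumes f: "f \<in> bounded_borel" and l: "0 < l" and s: "0 \<le> s"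
  shows "U s (R l f) = R l (U s f)"
proof
  fix x
  interpret Px: prob_space "P x" by (rule prob_P)
  interpret El: prob_space "expo l" by (rule prob_space_expo[OF l])
  interpret pair: pair_prob_space "P x" "expo l" ..
  obtain c where c: "\<And>x. \<bar>f x\<bar> \<le> c" using bounded_borelE[OF f] by metis
  have [measurable]: "X s \<in> measurable (P x) borel" by (rule X_measurable[OF s])
  have "(\<lambda>p. (snd p, X s (fst p))) \<in> P x \<Otimes>\<^sub>M expo l \<rightarrow>\<^sub>M borel \<Otimes>\<^sub>M borel"
    by measurable
  from measurable_compose[OF this U_jointly_measurable[OF f]]
  have int: "integrable (P x \<Otimes>\<^sub>M expo l) (\<lambda>(\<omega>, t). U (max 0 t) f (X s \<omega>))"
    using U_bound[OF f _ c] by (intro pair.integrable_const_bound[of _ c]) (auto simp: split_beta')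
  have "l * U s (R l f) x = (\<integral>\<omega>. l * R l f (X s \<omega>) \<partial>P x)"
    by (simp add: semigroup_of_def)
  also have "\<dots> = (\<integral>\<omega>. (\<integral>t. U (max 0 t) f (X s \<omega>) \<partial>expo l) \<partial>P x)"
    by (simp add: R_expo[OF f l])
  also have "\<dots> = (\<integral>t. (\<integral>\<omega>. U (max 0 t) f (X s \<omega>) \<partial>P x) \<partial>expo l)"
    using pair.Fubini_integral[OF int] by simp
  also have "\<dots> = (\<integral>t. U s (U (max 0 t) f) x \<partial>expo l)"
    by (simp add: semigroup_of_def)
  also have "\<dots> = (\<integral>t. U (max 0 t) (U s f) x \<partial>expo l)"
    using U_semigroup[OF f s] U_semigroup[OF f _ s] by (simp add: add.commute)
  also have "\<dots> = l * R l (U s f) x"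
    by (rule R_expo[OF U_bounded_borel[OF f s] l, symmetric])
  finally show "U s (R l f) x = R l (U s f) x"
    using l by simp
qed

text \<open>For fixed \<open>x\<close> everything depends on the scalar function \<open>?u\<close>:
  commuting \<open>U s\<close> with \<open>R m\<close> turns \<open>U s (R m f) x\<close> into the
  Laplace transform of \<open>?u\<close> shifted by \<open>s\<close>, and the scalar identity
  applies.\<close>

lemma R_identity:
  assumes f: "f \<in> bounded_borel" and l: "0 < l" and m: "0 < m"
  shows "R l f x - R m f x = (m - l) * R l (R m f) x"
proof -
  let ?u = "\<lambda>t. U (max 0 t) f x"
  obtain c where c: "\<And>x. \<bar>f x\<bar> \<le> c" using bounded_borelE[OF f] by metis
  have "U s (R m f) x = laplace (\<lambda>t. ?u (t + s)) m" if s: "0 \<le> s" for s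
  proof -
    have "U s (R m f) x = laplace (\<lambda>t. U (max 0 t) (U s f) x) m"
      using f m s by (simp add: U_R_commute R_laplace)
    also have "\<dots> = laplace (\<lambda>t. ?u (t + s)) m"
    proof (rule laplace_cong)
      fix t :: real assume "0 \<le> t"
      then show "U (max 0 t) (U s f) x = ?u (t + s)"
        using U_semigroup[OF f, of t s] s by (simp add: add.commute)
    qed
    finally show ?thesis .
  qed
  then have "R l (R m f) x = laplace (\<lambda>s. laplace (\<lambda>t. ?u (t + s)) m) l"
    unfolding R_laplace[of l] by (intro laplace_cong) simp
  then show ?thesis
    using laplace_resolvent_identity[OF U_time_measurable[OF f] U_bound[OF f _ c] l m, of x]
    by (simp add: R_laplace)
qed

lemma scaled_R_tendsto:
  assumes f: "f \<in> bounded_borel" and lim: "((\<lambda>t. U t f x) \<longlongrightarrow> f x) (at_right 0)"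
  shows "((\<lambda>l. l * R l f x) \<longlongrightarrow> f x) at_top"
proof -
  obtain c where c: "\<And>x. \<bar>f x\<bar> \<le> c" using bounded_borelE[OF f] by metis
  show ?thesis
    unfolding R_laplace
  proof (rule scaled_laplace_tendsto[where c = c])
    have "\<forall>\<^sub>F t in at_right (0::real). U t f x = U (max 0 t) f x"
      by (auto simp: eventually_at_filter)
    with lim show "((\<lambda>t. U (max 0 t) f x) \<longlongrightarrow> f x) (at_right 0)"
      by (rule Lim_transform_eventually)
  qed (use U_time_measurable[OF f] U_bound[OF f _ c] U_0[OF f] in auto)
qed

text \<open>The sequence \<open>y\<close> need not converge. With \<open>v t = U t f x\<close> this
  gives continuity of \<open>R l f\<close>, with \<open>v = 0\<close> vanishing at infinity.\<close>

lemma R_sequentially: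
  assumes f: "f \<in> bounded_borel" and l: "0 < l"
    and lim: "\<And>t. 0 \<le> t \<Longrightarrow> (\<lambda>n. U t f (y n)) \<longlonglongrightarrow> v t"
  shows "(\<lambda>n. R l f (y n)) \<longlonglongrightarrow> laplace v l"
proof -
  interpret prob_space "expo l" by (rule prob_space_expo[OF l])
  obtain c where c: "\<And>x. \<bar>f x\<bar> \<le> c" using bounded_borelE[OF f] by metis
  have lim': "(\<lambda>n. U (max 0 t) f (y n)) \<longlonglongrightarrow> v (max 0 t)" for t
    by (rule lim) simp
  have v: "(\<lambda>t. v (max 0 t)) \<in> borel_measurable borel"
    by (rule borel_measurable_LIMSEQ_real[OF lim' U_time_measurable[OF f]])
  have "(\<lambda>n. \<integral>t. U (max 0 t) f (y n) \<partial>expo l) \<longlonglongrightarrow> (\<integral>t. v (max 0 t) \<partial>expo l)"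
  proof (rule integral_dominated_convergence[where w = "\<lambda>_. c"])
    show "AE t in expo l. (\<lambda>n. U (max 0 t) f (y n)) \<longlonglongrightarrow> v (max 0 t)"
      using lim' by simp
  qed (use v U_time_measurable[OF f] U_bound[OF f _ c] in auto)
  then have "(\<lambda>n. l * R l f (y n)) \<longlonglongrightarrow> l * laplace (\<lambda>t. v (max 0 t)) l"
    using v l by (simp add: R_expo[OF f l] laplace_eq_expo)
  moreover have "laplace (\<lambda>t. v (max 0 t)) l = laplace v l"
    by (rule laplace_cong) simp
  ultimately show ?thesis
    using tendsto_mult_left_iff[of l] l by simp
qed

lemma R_C0_if_U_C0:
  assumes f: "f \<in> bounded_borel" and UC0: "\<And>t. 0 \<le> t \<Longrightarrow> U t f \<in> C0" and l: "0 < l"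
  shows "R l f \<in> C0"
proof (rule C0I)
  show cont: "continuous_on UNIV (R l f)"
    unfolding continuous_on_sequentially comp_def
  proof safe
    fix y :: "nat \<Rightarrow> 'e" and x assume y: "y \<longlonglongrightarrow> x"
    have "(\<lambda>n. U t f (y n)) \<longlonglongrightarrow> U t f x" if "0 \<le> t" for t
      using C0_continuous[OF UC0[OF that]] y by (auto simp: continuous_on_sequentially comp_def)
    then have "(\<lambda>n. R l f (y n)) \<longlonglongrightarrow> laplace (\<lambda>t. U t f x) l"
      by (rule R_sequentially[OF f l])
    then show "(\<lambda>n. R l f (y n)) \<longlonglongrightarrow> R l f x"
      by (simp add: resolvent_of_def laplace_def)
  qed
  fix e :: real assume e: "0 < e"
  have closed: "closed {x. e \<le> \<bar>R l f x\<bar>}"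
    using cont by (intro closed_Collect_le continuous_intros)
  show "compact {x. e \<le> \<bar>R l f x\<bar>}"
    unfolding compact_def
  proof (intro allI impI)
    fix y :: "nat \<Rightarrow> 'e" assume y: "\<forall>n. y n \<in> {x. e \<le> \<bar>R l f x\<bar>}"
    have "\<exists>x r. strict_mono r \<and> (y \<circ> r) \<longlonglongrightarrow> x"
    proof (rule ccontr)
      assume no_limit: "\<nexists>x r. strict_mono r \<and> (y \<circ> r) \<longlonglongrightarrow> x"
      \<comment> \<open>If this failed, infinitely many \<open>y n\<close> would lie in a compact
        superlevel set of \<open>U t f\<close>, and \<open>y\<close> would have a convergent
        subsequence.\<close>
      have "(\<lambda>n. U t f (y n)) \<longlonglongrightarrow> 0" if t: "0 \<le> t" for t
        unfolding tendsto_iff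
      proof (intro allI impI, rule ccontr)
        fix d :: real assume d: "0 < d"
        let ?K = "{x. d \<le> \<bar>U t f x\<bar>}"
        assume "\<not> (\<forall>\<^sub>F n in sequentially. dist (U t f (y n)) 0 < d)"
        then have "infinite {n. y n \<in> ?K}"
          by (simp add: not_eventually not_less INFM_iff_infinite flip: cofinite_eq_sequentially)
        then obtain r :: "nat \<Rightarrow> nat" where r: "strict_mono r" "\<And>n. y (r n) \<in> ?K"
          using infinite_enumerate by blast
        have "compact ?K"
          using UC0[OF t] d by (rule C0_compact_superlevel)
        then obtain x q where "strict_mono q" "((y \<circ> r) \<circ> q) \<longlonglongrightarrow> x"
          using r(2) unfolding compact_def by (metis comp_apply)
        then show False
          using no_limit strict_mono_o[OF r(1)] by (metis comp_assoc)
      qed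
      then have "(\<lambda>n. R l f (y n)) \<longlonglongrightarrow> laplace (\<lambda>_. 0) l"
        by (rule R_sequentially[OF f l])
      then have "(\<lambda>n. \<bar>R l f (y n)\<bar>) \<longlonglongrightarrow> 0"
        by (auto simp: laplace_def intro: tendsto_rabs_zero)
      then have "e \<le> 0"
        by (rule tendsto_lowerbound) (use y in auto)
      with e show False by simp
    qed
    then obtain x r where r: "strict_mono r" "(y \<circ> r) \<longlonglongrightarrow> x" by blast
    moreover have "x \<in> {x. e \<le> \<bar>R l f x\<bar>}"
      using closed_sequentially[OF closed _ r(2)] y by simp
    ultimately show "\<exists>x\<in>{x. e \<le> \<bar>R l f x\<bar>}. \<exists>r. strict_mono r \<and> (y \<circ> r) \<longlonglongrightarrow> x"
      by blast
  qed
qed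

lemma C0_resolvent_R:
  assumes "\<And>l f. 0 < l \<Longrightarrow> f \<in> C0 \<Longrightarrow> R l f \<in> C0"
  shows "C0_resolvent R"
proof
  fix l c :: real and x and f :: "'e \<Rightarrow> real" assume "0 < l" "f \<in> C0" "\<And>x. \<bar>f x\<bar> \<le> c"
  then show "l * \<bar>R l f x\<bar> \<le> c"
    using R_bound[of f l c x] by (simp add: C0_bounded_borel field_simps)
qed (use assms in \<open>simp_all add: fun_eq_iff C0_bounded_borel R_add R_scale R_nonneg R_identity\<close>)

end

section \<open>Sup norm and operator norm\<close>

lemma abs_le_sup_norm:
  assumes "f \<in> bounded_borel"
  shows "\<bar>f x\<bar> \<le> sup_norm f"
  unfolding sup_norm_def
proof (rule cSUP_upper)
  obtain c where "\<And>x. \<bar>f x\<bar> \<le> c" using bounded_borelE[OF assms] by metis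
  then show "bdd_above (range (\<lambda>x. \<bar>f x\<bar>))" by (intro bdd_aboveI2)
qed simp

lemma sup_norm_le: "(\<And>x. \<bar>f x\<bar> \<le> c) \<Longrightarrow> sup_norm f \<le> c"
  unfolding sup_norm_def by (rule cSUP_least) auto

lemma sup_norm_tendsto_0:
  assumes "\<And>e. 0 < e \<Longrightarrow> \<forall>\<^sub>F t in F. \<forall>x. \<bar>G t x\<bar> < e"
  shows "((\<lambda>t. sup_norm (G t)) \<longlongrightarrow> 0) F"
  unfolding tendsto_iff
proof (intro allI impI)
  fix e :: real assume e: "0 < e"
  \<comment> \<open>Halving is needed because the supremum of values below \<open>e\<close> may
    equal \<open>e\<close>.\<close>
  then have "\<forall>\<^sub>F t in F. \<forall>x. \<bar>G t x\<bar> < e/2" by (intro assms) simp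
  then show "\<forall>\<^sub>F t in F. dist (sup_norm (G t)) 0 < e"
  proof eventually_elim
    case (elim t)
    then have le: "\<bar>G t x\<bar> \<le> e/2" for x by (simp add: less_imp_le)
    then have "bdd_above (range (\<lambda>x. \<bar>G t x\<bar>))" by (intro bdd_aboveI2)
    \<comment> \<open>Any point will do: it shows that the supremum is nonnegative.\<close>
    then have "\<bar>G t undefined\<bar> \<le> sup_norm (G t)"
      unfolding sup_norm_def by (intro cSUP_upper) auto
    moreover have "sup_norm (G t) \<le> e/2" using le by (rule sup_norm_le)
    ultimately show ?case using e by (simp add: dist_real_def)
  qed
qed

lemma tendsto_0_if_sup_norm:
  assumes "((\<lambda>t. sup_norm (G t)) \<longlongrightarrow> 0) F" "\<forall>\<^sub>F t in F. G t \<in> bounded_borel"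
  shows "((\<lambda>t. G t x) \<longlongrightarrow> 0) F"
  by (rule Lim_null_comparison[OF eventually_mono[OF assms(2)] assms(1)]) (simp add: abs_le_sup_norm)

lemma op_norm_C0_le:
  assumes "\<And>f x. f \<in> C0 \<Longrightarrow> (\<And>x. \<bar>f x\<bar> \<le> 1) \<Longrightarrow> \<bar>T f x\<bar> \<le> k"
  shows "op_norm_C0 T \<le> ereal k"
  unfolding op_norm_C0_def
proof (rule SUP_least)
  fix f :: "'a \<Rightarrow> real" assume "f \<in> {f \<in> C0. sup_norm f \<le> 1}"
  then have f: "f \<in> C0" "sup_norm f \<le> 1" by auto
  have "\<bar>f x\<bar> \<le> 1" for x
    using order_trans[OF abs_le_sup_norm[OF C0_bounded_borel[OF f(1)]] f(2)] .
  then have "sup_norm (T f) \<le> k"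
    by (intro sup_norm_le assms f)
  then show "ereal (sup_norm (T f)) \<le> ereal k" by simp
qed

subsection \<open>From the resolvent to the semigroup\<close>

locale uniform_resolvent_process = measurable_markov_process A X P
  for A :: "'w measure" and X :: "real \<Rightarrow> 'w \<Rightarrow> 'e::metric_space" and P :: "'e \<Rightarrow> 'w measure" +
  assumes R_C0: "0 < l \<Longrightarrow> f \<in> C0 \<Longrightarrow> R l f \<in> C0"
    and R_uniform: "f \<in> C0 \<Longrightarrow> 0 < e \<Longrightarrow> \<forall>\<^sub>F l in at_top. \<forall>x. \<bar>l * R l f x - f x\<bar> < e"
begin

text \<open>The resolvent identity writes \<open>l * R l f\<close> as \<open>R 1 ?g\<close> with
  \<open>?g\<close> in \<open>C0\<close>, and \<open>l * R l f\<close> is uniformly close to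
  \<open>f\<close> for large \<open>l\<close>.\<close>

lemma range_R_dense:
  assumes f: "f \<in> C0" and e: "0 < e"
  shows "\<exists>g\<in>C0. \<forall>x. \<bar>f x - R 1 g x\<bar> < e"
proof -
  have "\<forall>\<^sub>F l in at_top. 0 < l \<and> (\<forall>x. \<bar>l * R l f x - f x\<bar> < e)"
    using R_uniform[OF f e] eventually_gt_at_top[of 0] by eventually_elim auto
  from eventually_happens'[OF trivial_limit_at_top_linorder this]
  obtain l where l: "0 < l" "\<And>x. \<bar>l * R l f x - f x\<bar> < e" by blast
  have bb: "f \<in> bounded_borel" "R l f \<in> bounded_borel"
    using f l by (auto intro: C0_bounded_borel R_bounded_borel)
  let ?g = "\<lambda>x. l * (f x + (1 - l) * R l f x)"
  have "R 1 ?g x = l * R l f x" for x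
  proof -
    have "R 1 ?g x = l * R 1 (\<lambda>x. f x + (1 - l) * R l f x) x"
      by (rule R_scale)
    also have "\<dots> = l * (R 1 f x + (1 - l) * R 1 (R l f) x)"
      using bb by (simp only: R_scale R_add bounded_borel_scale zero_less_one)
    finally have "R 1 ?g x = l * (R 1 f x + (1 - l) * R 1 (R l f) x)" .
    moreover have "R 1 f x + (1 - l) * R 1 (R l f) x = R l f x"
      using R_identity[OF bb(1), of 1 l x] l(1) by (simp add: algebra_simps)
    ultimately show ?thesis by simp
  qed
  moreover have "?g \<in> C0"
    by (intro C0_scale C0_add R_C0 f l)
  ultimately show ?thesis
    using l(2) by (intro bexI[of _ ?g]) (simp_all add: abs_minus_commute)
qed

text \<open>Shifting time by \<open>s\<close> cuts the interval from 0 to \<open>s\<close> off the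
  Laplace integral; the factor \<open>exp (- s)\<close> compensates the shift of the kernel. Both
  the Lipschitz and the first-order estimate start here.\<close>

lemma U_R_1:
  assumes g: "g \<in> bounded_borel" and s: "0 \<le> s"
  shows "exp (- s) * U s (R 1 g) x = R 1 g x - (LINT r:{0..<s}|lborel. exp (- r) * U (max 0 r) g x)"
proof -
  let ?u = "\<lambda>t. U (max 0 t) g x"
  obtain c where c: "\<And>x. \<bar>g x\<bar> \<le> c" using bounded_borelE[OF g] by metis
  have int: "set_integrable lborel {0..} (\<lambda>r. exp (- 1 * r) * ?u r)"
    by (rule set_integrable_laplace[OF U_time_measurable[OF g], where l = 1 and c = c]) (auto intro: U_bound g c)
  have "R 1 g x = (LINT r:{0..<s} \<union> {s..}|lborel. exp (- 1 * r) * ?u r)"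
    using s by (simp add: R_laplace laplace_def ivl_disj_un_one(8))
  also have "\<dots> = (LINT r:{0..<s}|lborel. exp (- 1 * r) * ?u r) + (LINT r:{s..}|lborel. exp (- 1 * r) * ?u r)"
    using s by (intro set_integral_Un set_integrable_subset[OF int]) auto
  finally have split: "R 1 g x = (LINT r:{0..<s}|lborel. exp (- 1 * r) * ?u r) + (LINT r:{s..}|lborel. exp (- 1 * r) * ?u r)" .
  have "U s (R 1 g) x = laplace (\<lambda>t. U (max 0 t) (U s g) x) 1"
    using g s by (simp add: U_R_commute R_laplace)
  also have "\<dots> = laplace (\<lambda>t. ?u (t + s)) 1"
  proof (rule laplace_cong)
    fix t :: real assume "0 \<le> t"
    then show "U (max 0 t) (U s g) x = ?u (t + s)"
      using U_semigroup[OF g, of t s] s by (simp add: add.commute)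
  qed
  also have "\<dots> = exp (1 * s) * (LINT r:{s..}|lborel. exp (- 1 * r) * ?u r)"
    by (rule laplace_shift[OF s])
  finally have "exp (- s) * U s (R 1 g) x = (LINT r:{s..}|lborel. exp (- 1 * r) * ?u r)"
    by (simp add: exp_minus)
  with split show ?thesis by simp
qed

text \<open>Used with \<open>a = 0\<close> for the crude size of the integral and with
  \<open>a = g x\<close> for its first-order behaviour.\<close>

lemma LINT_exp_U_estimate:
  assumes g: "g \<in> bounded_borel" and c: "\<And>x. \<bar>g x\<bar> \<le> c" and s: "0 \<le> s"
    and b: "\<And>r. 0 \<le> r \<Longrightarrow> r < s \<Longrightarrow> \<bar>exp (- r) * U r g x - a\<bar> \<le> b"
  shows "\<bar>(LINT r:{0..<s}|lborel. exp (- r) * U (max 0 r) g x) - s * a\<bar> \<le> s * b"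
proof -
  let ?v = "\<lambda>r. exp (- r) * U (max 0 r) g x"
  have "set_integrable lborel {0..} (\<lambda>r. exp (- 1 * r) * U (max 0 r) g x)"
    by (rule set_integrable_laplace[OF U_time_measurable[OF g], where l = 1 and c = c]) (auto intro: U_bound g c)
  then have v: "set_integrable lborel {0..<s} ?v"
    by (rule set_integrable_subset[THEN set_integrable_cong[OF refl refl, THEN iffD1, rotated]]) auto
  have const: "set_integrable lborel {0..<s} (\<lambda>_. k)" "(LINT r:{0..<s}|lborel. k) = s * k" for k :: real
    using s by (auto simp: set_integrable_def set_lebesgue_integral_def)
  have "(LINT r:{0..<s}|lborel. ?v r) - s * a = (LINT r:{0..<s}|lborel. ?v r - a)"
    using v const by (simp add: set_integral_diff)
  also have "\<bar>\<dots>\<bar> \<le> (LINT r:{0..<s}|lborel. \<bar>?v r - a\<bar>)"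
    using set_integral_norm_bound[OF set_integral_diff(1)[OF v const(1)], of a] by simp
  also have "\<dots> \<le> (LINT r:{0..<s}|lborel. b)"
    using b by (intro set_integral_mono set_integrable_abs set_integral_diff v const) auto
  finally show ?thesis by (simp add: const)
qed

text \<open>One \<open>c * s\<close> comes from \<open>1 - exp (- s) \<le> s\<close>, the other from
  the integral in \<open>U_R_1\<close>.\<close>

lemma U_R_1_continuous:
  assumes g: "g \<in> bounded_borel" and c: "\<And>x. \<bar>g x\<bar> \<le> c" and s: "0 \<le> s"
  shows "\<bar>U s (R 1 g) x - R 1 g x\<bar> \<le> 2 * c * s"
proof -
  let ?I = "LINT r:{0..<s}|lborel. exp (- r) * U (max 0 r) g x"
  have "0 \<le> c" using c[of undefined] by linarith
  have "\<bar>exp (- r) * U r g x\<bar> \<le> c" if "0 \<le> r" for r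
  proof -
    have "\<bar>exp (- r) * U r g x\<bar> \<le> 1 * c"
      unfolding abs_mult using that U_bound[OF g that c] by (intro mult_mono) auto
    then show ?thesis by simp
  qed
  then have I: "\<bar>?I\<bar> \<le> s * c"
    using LINT_exp_U_estimate[OF g c s, of x 0 c] by simp
  have "\<bar>R 1 g y\<bar> \<le> c" for y
    using R_bound[OF g _ c, of 1 y] by simp
  then have U: "\<bar>U s (R 1 g) x\<bar> \<le> c"
    using g s by (intro U_bound R_bounded_borel) auto
  have "0 \<le> 1 - exp (- s)" "1 - exp (- s) \<le> s"
    using s exp_ge_add_one_self[of "- s"] by auto
  then have "\<bar>(1 - exp (- s)) * U s (R 1 g) x\<bar> \<le> s * c"
    unfolding abs_mult using U \<open>0 \<le> c\<close> by (intro mult_mono) auto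
  moreover have "U s (R 1 g) x - R 1 g x = (1 - exp (- s)) * U s (R 1 g) x - ?I"
    using U_R_1[OF g s, of x] by (simp add: algebra_simps)
  ultimately show ?thesis using I by (simp add: mult_ac)
qed

text \<open>The Lipschitz bound on the range of \<open>R 1\<close> extends to its closure, since
  every \<open>U s\<close> is a contraction. The threshold \<open>e / (6 * c)\<close> makes
  \<open>2 * c * s\<close> smaller than \<open>e / 3\<close>.\<close>

lemma U_strongly_continuous:
  assumes f: "f \<in> C0" and e: "0 < e"
  shows "\<exists>d>0. \<forall>s x. 0 \<le> s \<longrightarrow> s < d \<longrightarrow> \<bar>U s f x - f x\<bar> < e"
proof -
  obtain g where g: "g \<in> C0" "\<And>x. \<bar>f x - R 1 g x\<bar> < e/3"
    using range_R_dense[OF f, of "e/3"] e by auto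
  obtain c where c: "0 < c" "\<And>x. \<bar>g x\<bar> \<le> c"
    using C0_boundedE[OF g(1)] by metis
  have bb: "f \<in> bounded_borel" "g \<in> bounded_borel" "R 1 g \<in> bounded_borel"
    using f g(1) by (auto intro: C0_bounded_borel R_bounded_borel)
  have "\<bar>U s f x - f x\<bar> < e" if s: "0 \<le> s" "s < e / (6 * c)" for s x
  proof -
    have "\<bar>U s (\<lambda>x. f x - R 1 g x) x\<bar> \<le> e/3"
      using g(2) by (intro U_bound bounded_borel_diff bb s) (auto intro: less_imp_le)
    then have "\<bar>U s f x - U s (R 1 g) x\<bar> \<le> e/3"
      using bb s by (simp add: U_diff)
    moreover have "2 * c * s < e/3"
      using s(2) c(1) by (simp add: field_simps)
    moreover have "\<bar>U s (R 1 g) x - R 1 g x\<bar> \<le> 2 * c * s"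
      by (rule U_R_1_continuous[OF bb(2) c(2) s(1)])
    ultimately show ?thesis
      using g(2)[of x] by linarith
  qed
  moreover have "0 < e / (6 * c)" using e c by simp
  ultimately show ?thesis by blast
qed

text \<open>The generator maps \<open>R 1 g\<close> to \<open>R 1 g - g\<close>.\<close>

lemma U_R_1_differentiable:
  assumes g: "g \<in> bounded_borel" and c: "\<And>x. \<bar>g x\<bar> \<le> c" and s: "0 \<le> s" "s \<le> 1"
    and \<eta>: "\<And>r x. 0 \<le> r \<Longrightarrow> r < s \<Longrightarrow> \<bar>U r g x - g x\<bar> \<le> \<eta>"
  shows "\<bar>U s (R 1 g) x - R 1 g x - s * (R 1 g x - g x)\<bar> \<le> s * (\<eta> + 4 * c * s)"
proof -
  let ?I = "LINT r:{0..<s}|lborel. exp (- r) * U (max 0 r) g x"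
  have c0: "0 \<le> c" using c[of undefined] by linarith
  have "\<bar>exp (- r) * U r g x - g x\<bar> \<le> \<eta> + c * s" if r: "0 \<le> r" "r < s" for r
  proof -
    have "0 \<le> 1 - exp (- r)" "1 - exp (- r) \<le> s"
      using r exp_ge_add_one_self[of "- r"] by auto
    then have "\<bar>(1 - exp (- r)) * g x\<bar> \<le> s * c"
      unfolding abs_mult using c c0 s by (intro mult_mono) auto
    moreover have "\<bar>exp (- r) * (U r g x - g x)\<bar> \<le> 1 * \<eta>"
      unfolding abs_mult using r \<eta>[OF r] by (intro mult_mono) auto
    moreover have "exp (- r) * U r g x - g x = exp (- r) * (U r g x - g x) - (1 - exp (- r)) * g x"
      by (simp add: algebra_simps)
    ultimately show ?thesis by (simp add: mult.commute)
  qed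
  then have 1: "\<bar>?I - s * g x\<bar> \<le> s * (\<eta> + c * s)"
    by (rule LINT_exp_U_estimate[OF g c s(1)])
  have "\<bar>exp (- r) * U r g x - 0\<bar> \<le> c" if "0 \<le> r" for r
  proof -
    have "\<bar>exp (- r) * U r g x\<bar> \<le> 1 * c"
      unfolding abs_mult using that U_bound[OF g that c] by (intro mult_mono) auto
    then show ?thesis by simp
  qed
  then have I: "\<bar>?I - s * 0\<bar> \<le> s * c"
    by (intro LINT_exp_U_estimate[OF g c s(1)])
  have R: "\<bar>R 1 g x\<bar> \<le> c"
    using R_bound[OF g _ c, of 1 x] by simp
  have exp1: "0 \<le> exp s - 1 - s" "exp s - 1 - s \<le> s * s"
    using exp_ge_add_one_self[of s] exp_bound[OF s] unfolding power2_eq_square by linarith+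
  moreover have "s * s \<le> s" using s by (simp add: mult_left_le)
  ultimately have exp2: "0 \<le> exp s - 1" "exp s - 1 \<le> 2 * s"
    using s by auto
  have 2: "\<bar>(exp s - 1 - s) * R 1 g x\<bar> \<le> (s * s) * c"
    unfolding abs_mult using exp1 R c0 s by (intro mult_mono) auto
  have 3: "\<bar>(exp s - 1) * ?I\<bar> \<le> (2 * s) * (s * c)"
    unfolding abs_mult using exp2 I c0 s by (intro mult_mono) auto
  have "U s (R 1 g) x = exp s * (exp (- s) * U s (R 1 g) x)"
    by (simp add: exp_minus)
  also have "\<dots> = exp s * (R 1 g x - ?I)"
    by (simp only: U_R_1[OF g s(1)])
  finally have "U s (R 1 g) x - R 1 g x - s * (R 1 g x - g x)
      = (exp s - 1 - s) * R 1 g x - (exp s - 1) * ?I - (?I - s * g x)"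
    by (simp add: algebra_simps)
  \<comment> \<open>The constant 4 in the claim is \<open>1 + 2 + 1\<close>: one from the quadratic
    remainder of \<open>exp s\<close>, two from \<open>exp s - 1 \<le> 2 * s\<close>, one from the
    integral.\<close>
  then have "\<bar>U s (R 1 g) x - R 1 g x - s * (R 1 g x - g x)\<bar>
      \<le> (s * s) * c + (2 * s) * (s * c) + s * (\<eta> + c * s)"
    using 1 2 3 by linarith
  then show ?thesis
    by (simp add: algebra_simps)
qed

text \<open>The resolvent identity gives \<open>l * R l (R 1 g) = R 1 g + R l ?h\<close>, where
  \<open>R l ?h\<close> is close to \<open>?h / l\<close>; the differentiability estimate at
  \<open>s = 1 / l\<close> gives the same first-order expansion for
  \<open>U (1 / l) (R 1 g)\<close>.\<close>

lemma scaled_R_minus_U: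
  assumes g: "g \<in> C0" and e: "0 < e"
  shows "\<forall>\<^sub>F l in at_top. \<forall>x. \<bar>l * R l (R 1 g) x - U (1 / l) (R 1 g) x\<bar> \<le> e / l"
proof -
  let ?h = "\<lambda>x. R 1 g x - g x"
  obtain c where c: "0 < c" "\<And>x. \<bar>g x\<bar> \<le> c"
    using C0_boundedE[OF g] by metis
  have bb: "g \<in> bounded_borel" "R 1 g \<in> bounded_borel"
    using g by (auto intro: C0_bounded_borel R_bounded_borel)
  have "?h \<in> C0" using g by (intro C0_diff R_C0) auto
  from R_uniform[OF this, of "e/3"] e
  have 1: "\<forall>\<^sub>F l in at_top. \<forall>x. \<bar>l * R l ?h x - ?h x\<bar> < e/3" by simp
  obtain d where d: "0 < d" "\<And>r x. 0 \<le> r \<Longrightarrow> r < d \<Longrightarrow> \<bar>U r g x - g x\<bar> < e/3"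
    using U_strongly_continuous[OF g, of "e/3"] e by auto
  have lim: "((\<lambda>l::real. k / l) \<longlongrightarrow> 0) at_top" for k :: real
    by (intro tendsto_divide_0[OF tendsto_const] filterlim_at_top_imp_at_infinity filterlim_ident)
  have "0 < e/3" using e by simp
  \<comment> \<open>The budget \<open>e\<close> is shared by the resolvent error for
    \<open>?h\<close>, the modulus of continuity of \<open>U r g\<close> at 0 and the term
    \<open>4 * c / l\<close>; \<open>l \<ge> 1\<close> ensures \<open>1 / l \<le> 1\<close> for the
    exponential bounds.\<close>
  from 1 order_tendstoD(2)[OF lim[of 1] d(1)] order_tendstoD(2)[OF lim[of "4 * c"] this]
    eventually_ge_at_top[of 1]
  show ?thesis
  proof eventually_elim
    case (elim l)
    show ?case
    proof
      fix x
      have "\<bar>U (1/l) (R 1 g) x - R 1 g x - 1/l * ?h x\<bar> \<le> 1/l * (e/3 + 4 * c * (1/l))"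
        using elim d(2) by (intro U_R_1_differentiable bb c) (auto intro!: less_imp_le)
      also have "\<dots> \<le> 1/l * (2 * e/3)"
        using elim by (intro mult_left_mono) auto
      finally have 2: "\<bar>U (1/l) (R 1 g) x - R 1 g x - 1/l * ?h x\<bar> \<le> 1/l * (2 * e/3)" .
      have "1/l * \<bar>l * R l ?h x - ?h x\<bar> \<le> 1/l * (e/3)"
        using elim by (intro mult_left_mono) (auto intro: less_imp_le)
      then have 3: "\<bar>R l ?h x - 1/l * ?h x\<bar> \<le> 1/l * (e/3)"
        using elim by (simp add: abs_mult field_simps flip: abs_mult_pos)
      have "l * R l (R 1 g) x = R 1 g x + R l ?h x"
        using R_identity[OF bb(1), of l 1 x] elim R_diff[OF bb(2,1), of l x] by (simp add: algebra_simps)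
      then have "l * R l (R 1 g) x - U (1/l) (R 1 g) x
          = (R l ?h x - 1/l * ?h x) - (U (1/l) (R 1 g) x - R 1 g x - 1/l * ?h x)"
        by simp
      then have "\<bar>l * R l (R 1 g) x - U (1/l) (R 1 g) x\<bar> \<le> 1/l * (e/3) + 1/l * (2 * e/3)"
        using order_trans[OF abs_triangle_ineq4 add_mono[OF 3 2]] by simp
      then show "\<bar>l * R l (R 1 g) x - U (1 / l) (R 1 g) x\<bar> \<le> e / l"
        by (simp add: field_simps)
    qed
  qed
qed

text \<open>One more step splits into \<open>l * R l\<close> applied to the previous error plus
  \<open>U (n / l)\<close> applied to the one-step error of \<open>f\<close>. Both operators are
  contractions, so each step adds at most \<open>b\<close>; since they commute, a one-step bound for
  \<open>f\<close> alone suffices.\<close>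

lemma funpow_scaled_R_minus_U:
  assumes f: "f \<in> bounded_borel" and l: "0 < l"
    and b: "\<And>x. \<bar>l * R l f x - U (1 / l) f x\<bar> \<le> b"
  shows "((\<lambda>f x. l * R l f x) ^^ n) f \<in> bounded_borel \<and>
    (\<forall>x. \<bar>((\<lambda>f x. l * R l f x) ^^ n) f x - U (n / l) f x\<bar> \<le> n * b)"
proof (induction n)
  case 0
  then show ?case using f by (simp add: U_0)
next
  case (Suc n)
  let ?Q = "((\<lambda>f x. l * R l f x) ^^ n) f"
  have bb: "?Q \<in> bounded_borel" "U (n / l) f \<in> bounded_borel" "R l f \<in> bounded_borel" "U (1 / l) f \<in> bounded_borel"
    using Suc l f by (auto intro: U_bounded_borel R_bounded_borel)
  have "\<bar>l * R l ?Q x - U (Suc n / l) f x\<bar> \<le> Suc n * b" for x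
  proof -
    have "\<bar>R l (\<lambda>x. ?Q x - U (n / l) f x) x\<bar> \<le> n * b / l"
      using Suc l bb by (intro R_bound bounded_borel_diff) auto
    then have 1: "\<bar>l * (R l ?Q x - R l (U (n / l) f) x)\<bar> \<le> n * b"
      using l bb by (simp add: R_diff abs_mult pos_le_divide_eq mult.commute)
    have "\<bar>U (n / l) (\<lambda>x. l * R l f x - U (1 / l) f x) x\<bar> \<le> b"
      using b l bb by (intro U_bound bounded_borel_diff bounded_borel_scale) auto
    then have 2: "\<bar>l * U (n / l) (R l f) x - U (n / l) (U (1 / l) f) x\<bar> \<le> b"
      using l bb by (simp add: U_diff U_scale bounded_borel_scale)
    have "U (Suc n / l) f = U (n / l) (U (1 / l) f)"
      using U_semigroup[OF f, of "n / l" "1 / l"] l by (simp add: add_divide_distrib add.commute)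
    moreover have "U (n / l) (R l f) = R l (U (n / l) f)"
      using U_R_commute[OF f l] l by simp
    ultimately have "l * R l ?Q x - U (Suc n / l) f x = l * (R l ?Q x - R l (U (n / l) f) x)
        + (l * U (n / l) (R l f) x - U (n / l) (U (1 / l) f) x)"
      by (simp add: algebra_simps)
    then have "\<bar>l * R l ?Q x - U (Suc n / l) f x\<bar> \<le> n * b + b"
      using 1 2 by linarith
    then show ?thesis by (simp add: algebra_simps)
  qed
  then show ?case
    using bb l by (simp add: bounded_borel_scale R_bounded_borel)
qed

lemma funpow_scaled_R_C0: "f \<in> C0 \<Longrightarrow> 0 < l \<Longrightarrow> ((\<lambda>f x. l * R l f x) ^^ n) f \<in> C0"
  by (induction n) (auto intro: C0_scale R_C0)

lemma U_R_1_C0: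
  assumes g: "g \<in> C0" and t: "0 < t"
  shows "U t (R 1 g) \<in> C0"
proof (rule C0_approx_closed)
  fix e :: real assume e: "0 < e"
  have f: "R 1 g \<in> C0" using g by (intro R_C0) auto
  \<comment> \<open>With \<open>l = n / t\<close>, the \<open>n\<close> telescoping errors of size
    \<open>e / (2 * t) / l\<close> add up to \<open>e / 2\<close>.\<close>
  have "\<forall>\<^sub>F l in at_top. \<forall>x. \<bar>l * R l (R 1 g) x - U (1 / l) (R 1 g) x\<bar> \<le> e / (2 * t) / l"
    using e t by (intro scaled_R_minus_U g) auto
  moreover have "filterlim (\<lambda>n. real n / t) at_top sequentially"
    using t filterlim_tendsto_pos_mult_at_top[OF tendsto_const _ filterlim_real_sequentially, of "1 / t"] by simp
  ultimately have "\<forall>\<^sub>F n in sequentially. \<forall>x. \<bar>(n / t) * R (n / t) (R 1 g) x - U (1 / (n / t)) (R 1 g) x\<bar>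
      \<le> e / (2 * t) / (n / t)"
    by (rule eventually_compose_filterlim)
  then have "\<forall>\<^sub>F n in sequentially. 0 < n \<and> (\<forall>x. \<bar>(n / t) * R (n / t) (R 1 g) x - U (1 / (n / t)) (R 1 g) x\<bar>
      \<le> e / (2 * t) / (n / t))"
    using eventually_gt_at_top[of "0::nat"] by eventually_elim auto
  from eventually_happens'[OF sequentially_bot this]
  obtain n :: nat where n: "0 < n"
    "\<And>x. \<bar>(n / t) * R (n / t) (R 1 g) x - U (1 / (n / t)) (R 1 g) x\<bar> \<le> e / (2 * t) / (n / t)"
    by blast
  let ?Q = "((\<lambda>f x. (n / t) * R (n / t) f x) ^^ n) (R 1 g)"
  have "\<bar>?Q x - U (n / (n / t)) (R 1 g) x\<bar> \<le> n * (e / (2 * t) / (n / t))" for x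
    using funpow_scaled_R_minus_U[OF C0_bounded_borel[OF f] _ n(2), of n] n(1) t by simp
  then have close: "\<bar>?Q x - U t (R 1 g) x\<bar> \<le> e/2" for x
    using n(1) t by simp
  have "\<bar>U t (R 1 g) x - ?Q x\<bar> < e" for x
    using close[of x] e by linarith
  moreover have "?Q \<in> C0"
    using n t by (intro funpow_scaled_R_C0 f) auto
  ultimately show "\<exists>h\<in>C0. \<forall>x. \<bar>U t (R 1 g) x - h x\<bar> < e" by blast
qed

text \<open>Density of the range of \<open>R 1\<close> and contractivity of \<open>U t\<close>
  extend \<open>U_R_1_C0\<close> to all of \<open>C0\<close>. Time 0 is separate because the choice
  \<open>l = n / t\<close> needs \<open>t > 0\<close>.\<close>

lemma U_C0:
  assumes f: "f \<in> C0" and t: "0 \<le> t"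
  shows "U t f \<in> C0"
proof (cases "t = 0")
  case False
  show ?thesis
  proof (rule C0_approx_closed)
    fix e :: real assume e: "0 < e"
    obtain g where g: "g \<in> C0" "\<And>x. \<bar>f x - R 1 g x\<bar> < e/2"
      using range_R_dense[OF f, of "e/2"] e by auto
    have bb: "f \<in> bounded_borel" "R 1 g \<in> bounded_borel"
      using f g(1) by (auto intro: C0_bounded_borel R_bounded_borel)
    have "\<bar>U t f x - U t (R 1 g) x\<bar> < e" for x
    proof -
      have "\<bar>U t (\<lambda>x. f x - R 1 g x) x\<bar> \<le> e/2"
        using g(2) by (intro U_bound bounded_borel_diff bb t) (auto intro: less_imp_le)
      then show ?thesis
        using bb t e by (simp add: U_diff)
    qed
    moreover have "U t (R 1 g) \<in> C0"
      using False t g by (intro U_R_1_C0) auto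
    ultimately show "\<exists>h\<in>C0. \<forall>x. \<bar>U t f x - h x\<bar> < e" by blast
  qed
qed (use f in \<open>simp add: U_0 C0_bounded_borel\<close>)

lemma feller_semigroup_U: "feller_semigroup U"
  unfolding feller_semigroup_def
proof (intro conjI ballI allI impI)
  fix t :: real assume t: "0 \<le> t"
  show "positive_linear_operator_C0 (U t)"
    unfolding positive_linear_operator_C0_def
    using t by (auto simp: fun_eq_iff U_C0 U_add U_scale U_nonneg C0_bounded_borel)
  show "op_norm_C0 (U t) \<le> 1"
    using op_norm_C0_le[of "U t" 1] U_bound[OF C0_bounded_borel t] by (simp add: one_ereal_def)
next
  fix s t :: real and f :: "'e \<Rightarrow> real" assume "0 \<le> s" "0 \<le> t" "f \<in> C0"
  then show "U (t + s) f = U t (U s f)"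
    using U_semigroup[of f t s] by (simp add: C0_bounded_borel add.commute)
next
  fix f :: "'e \<Rightarrow> real" assume f: "f \<in> C0"
  show "U 0 f = f"
    by (rule U_0[OF C0_bounded_borel[OF f]])
  show "((\<lambda>t. sup_norm (\<lambda>x. U t f x - f x)) \<longlongrightarrow> 0) (at_right 0)"
  proof (rule sup_norm_tendsto_0)
    fix e :: real assume "0 < e"
    then obtain d where "0 < d" "\<And>s x. 0 \<le> s \<Longrightarrow> s < d \<Longrightarrow> \<bar>U s f x - f x\<bar> < e"
      using U_strongly_continuous[OF f] by blast
    then show "\<forall>\<^sub>F t in at_right 0. \<forall>x. \<bar>U t f x - f x\<bar> < e"
      unfolding eventually_at_right_field by (intro exI[of _ d]) simp
  qed
qed

lemma feller_resolvent_R: "feller_resolvent R"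
  unfolding feller_resolvent_def
proof (intro conjI ballI allI impI)
  fix l :: real assume l: "0 < l"
  show "positive_linear_operator_C0 (R l)"
    unfolding positive_linear_operator_C0_def
    using l by (auto simp: fun_eq_iff R_C0 R_add R_scale R_nonneg C0_bounded_borel)
  show "op_norm_C0 (R l) \<le> ereal (1 / l)"
    by (rule op_norm_C0_le) (rule R_bound[OF C0_bounded_borel l])
next
  fix f :: "'e \<Rightarrow> real" assume f: "f \<in> C0"
  show "((\<lambda>l. sup_norm (\<lambda>x. l * R l f x - f x)) \<longlongrightarrow> 0) at_top"
    by (rule sup_norm_tendsto_0) (rule R_uniform[OF f])
qed (simp add: R_identity C0_bounded_borel)

end

section \<open>Assembling the equivalences\<close>

context measurable_markov_process
begin

lemma feller_semigroup_imp_pointwise: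
  assumes "feller_semigroup U"
  shows "\<forall>t\<ge>0. U t ` C0 \<subseteq> C0" "\<forall>f\<in>C0. \<forall>x. ((\<lambda>t. U t f x) \<longlongrightarrow> f x) (at_right 0)"
proof -
  show C0: "\<forall>t\<ge>0. U t ` C0 \<subseteq> C0"
    using assms by (auto simp: feller_semigroup_def positive_linear_operator_C0_def)
  show "\<forall>f\<in>C0. \<forall>x. ((\<lambda>t. U t f x) \<longlongrightarrow> f x) (at_right 0)"
  proof (intro ballI allI)
    fix f :: "'e \<Rightarrow> real" and x assume f: "f \<in> C0"
    have "((\<lambda>t. U t f x - f x) \<longlongrightarrow> 0) (at_right 0)"
    proof (rule tendsto_0_if_sup_norm[where G = "\<lambda>t x. U t f x - f x"])
      show "((\<lambda>t. sup_norm (\<lambda>x. U t f x - f x)) \<longlongrightarrow> 0) (at_right 0)"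
        using assms f by (simp add: feller_semigroup_def)
      show "\<forall>\<^sub>F t in at_right 0. (\<lambda>x. U t f x - f x) \<in> bounded_borel"
        using eventually_at_right_less[of 0]
        by eventually_elim (use f in \<open>intro bounded_borel_diff U_bounded_borel C0_bounded_borel less_imp_le\<close>)
    qed
    then show "((\<lambda>t. U t f x) \<longlongrightarrow> f x) (at_right 0)"
      by (rule LIM_zero_cancel)
  qed
qed

lemma feller_resolvent_imp_pointwise:
  assumes "feller_resolvent R"
  shows "\<forall>l>0. R l ` C0 \<subseteq> C0" "\<forall>f\<in>C0. \<forall>x. ((\<lambda>l. l * R l f x) \<longlongrightarrow> f x) at_top"
proof -
  show C0: "\<forall>l>0. R l ` C0 \<subseteq> C0"
    using assms by (auto simp: feller_resolvent_def positive_linear_operator_C0_def)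
  show "\<forall>f\<in>C0. \<forall>x. ((\<lambda>l. l * R l f x) \<longlongrightarrow> f x) at_top"
  proof (intro ballI allI)
    fix f :: "'e \<Rightarrow> real" and x assume f: "f \<in> C0"
    have "((\<lambda>l. l * R l f x - f x) \<longlongrightarrow> 0) at_top"
    proof (rule tendsto_0_if_sup_norm[where G = "\<lambda>l x. l * R l f x - f x"])
      show "((\<lambda>l. sup_norm (\<lambda>x. l * R l f x - f x)) \<longlongrightarrow> 0) at_top"
        using assms f by (simp add: feller_resolvent_def)
      show "\<forall>\<^sub>F l in at_top. (\<lambda>x. l * R l f x - f x) \<in> bounded_borel"
        using eventually_gt_at_top[of 0]
        by eventually_elim (use f in \<open>intro bounded_borel_diff bounded_borel_scale R_bounded_borel C0_bounded_borel\<close>)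
    qed
    then show "((\<lambda>l. l * R l f x) \<longlongrightarrow> f x) at_top"
      by (rule LIM_zero_cancel)
  qed
qed

lemma uniform_resolvent_processI:
  assumes "\<forall>l>0. R l ` C0 \<subseteq> C0" "\<forall>f\<in>C0. \<forall>x. ((\<lambda>l. l * R l f x) \<longlongrightarrow> f x) at_top"
  shows "uniform_resolvent_process A X P"
proof -
  have R_C0: "R l f \<in> C0" if "0 < l" "f \<in> C0" for l f
    using assms(1) that by blast
  have "pointwise_continuous_C0_resolvent R"
    using C0_resolvent_R[OF R_C0] assms(2)
    by (simp add: pointwise_continuous_C0_resolvent_def pointwise_continuous_C0_resolvent_axioms_def)
  from pointwise_continuous_C0_resolvent.uniform_convergence[OF this] R_C0
  show ?thesis
    by unfold_locales
qed

text \<open>All paths run through (f). Invariance of \<open>C0\<close> and pointwise convergence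
  each pass from the semigroup to the resolvent independently, so (c), (d) and (e) each yield (f);
  conversely (f) gives (a) and (b), and (a) supplies all four conjuncts.\<close>

lemma feller_equivalence:
  defines "U_C0 \<equiv> \<forall>t\<ge>0. U t ` C0 \<subseteq> C0" and "R_C0 \<equiv> \<forall>l>0. R l ` C0 \<subseteq> C0"
    and "U_pointwise \<equiv> \<forall>f\<in>C0. \<forall>x. ((\<lambda>t. U t f x) \<longlongrightarrow> f x) (at_right 0)"
    and "R_pointwise \<equiv> \<forall>f\<in>C0. \<forall>x. ((\<lambda>l. l * R l f x) \<longlongrightarrow> f x) at_top"
  shows "(feller_semigroup U \<longleftrightarrow> feller_resolvent R) \<and>
    (feller_semigroup U \<longleftrightarrow> U_C0 \<and> U_pointwise) \<and>
    (feller_semigroup U \<longleftrightarrow> U_C0 \<and> R_pointwise) \<and>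
    (feller_semigroup U \<longleftrightarrow> R_C0 \<and> U_pointwise) \<and>
    (feller_semigroup U \<longleftrightarrow> R_C0 \<and> R_pointwise)"
proof -
  have "U_C0 \<and> U_pointwise" if "feller_semigroup U"
    unfolding U_C0_def U_pointwise_def using feller_semigroup_imp_pointwise[OF that] by blast
  moreover have "R_C0" if U_C0
    unfolding R_C0_def
  proof safe
    fix l :: real and f :: "'e \<Rightarrow> real" assume "0 < l" "f \<in> C0"
    then show "R l f \<in> C0"
      using that by (intro R_C0_if_U_C0 C0_bounded_borel) (auto simp: U_C0_def)
  qed
  moreover have "R_pointwise" if U_pointwise
    unfolding R_pointwise_def
    using that by (intro ballI allI scaled_R_tendsto C0_bounded_borel) (auto simp: U_pointwise_def)
  moreover have "R_C0 \<and> R_pointwise" if "feller_resolvent R"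
    unfolding R_C0_def R_pointwise_def using feller_resolvent_imp_pointwise[OF that] by blast
  moreover have "feller_semigroup U" "feller_resolvent R" if "R_C0" "R_pointwise"
  proof -
    interpret uniform_resolvent_process A X P
      using that unfolding R_C0_def R_pointwise_def by (rule uniform_resolvent_processI)
    show "feller_semigroup U" "feller_resolvent R"
      by (rule feller_semigroup_U feller_resolvent_R)+
  qed
  ultimately show ?thesis by blast
qed

end

theorem mainTheorem1:
  fixes A :: "'w measure"
    and X :: "real \<Rightarrow> 'w \<Rightarrow> 'e::metric_space"
    and P :: "'e \<Rightarrow> 'w measure"
    and U R :: "real \<Rightarrow> ('e \<Rightarrow> real) \<Rightarrow> ('e \<Rightarrow> real)"
  assumes "locally_compact_space (euclidean :: 'e topology)"
    and "separable_space (euclidean :: 'e topology)"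
    and "markov_process A X P"
    and "\<And>f. f \<in> bounded_borel \<Longrightarrow>
      (\<lambda>(t, x). \<integral>\<omega>. f (X t \<omega>) \<partial>P x)
        \<in> borel_measurable (restrict_space borel {0..} \<Otimes>\<^sub>M borel)"
    and "U = semigroup_of P X"
    and "R = resolvent_of P X"
  shows
    "(feller_semigroup U \<longleftrightarrow> feller_resolvent R) \<and>
     (feller_semigroup U \<longleftrightarrow>
        (\<forall>t\<ge>0. U t ` C0 \<subseteq> C0) \<and> (\<forall>f\<in>C0. \<forall>x. ((\<lambda>t. U t f x) \<longlongrightarrow> f x) (at_right 0))) \<and>
     (feller_semigroup U \<longleftrightarrow>
        (\<forall>t\<ge>0. U t ` C0 \<subseteq> C0) \<and> (\<forall>f\<in>C0. \<forall>x. ((\<lambda>l. l * R l f x) \<longlongrightarrow> f x) at_top)) \<and>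
     (feller_semigroup U \<longleftrightarrow>
        (\<forall>l>0. R l ` C0 \<subseteq> C0) \<and> (\<forall>f\<in>C0. \<forall>x. ((\<lambda>t. U t f x) \<longlongrightarrow> f x) (at_right 0))) \<and>
     (feller_semigroup U \<longleftrightarrow>
        (\<forall>l>0. R l ` C0 \<subseteq> C0) \<and> (\<forall>f\<in>C0. \<forall>x. ((\<lambda>l. l * R l f x) \<longlongrightarrow> f x) at_top))"
proof -
  interpret measurable_markov_process A X P
    using assms(3,4) by (intro measurable_markov_process.intro measurable_markov_process_axioms.intro)
  show ?thesis
    unfolding assms(5,6) by (rule feller_equivalence)
qed

end
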